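(* Let $a\in C^1(\mathbb T)$ be real valued with $0<\inf_{\mathbb T} a<\sup_{\mathbb T} a<\infty$. Put $\kappa=\big(\mathbb E[a^{-1}]\big)^{-1}$, $q(x)=\kappa^{-1}-a(x)^{-1}$ and $$c_a=\frac{\kappa}{8}\Big(\mathbb E\big[q^2(x)\big]+2\sum_{s=1}^\infty\mathbb E\big[q(x)q(2^sx)\big]\Big).$$ Suppose $c_a>0$. Then for every $\varepsilon>0$ there exist constants $c=c(\varepsilon)>0$ and $E_0=E_0(\varepsilon)>0$ such that for all $0<E<E_0$ there exists $N_0=N_0(E,\varepsilon)$ such that for all $N\ge N_0$, $$\mathbb P\Big(x\in\mathbb T:\Big|\frac1N\log\|T_N^E(x)\|-c_aE\Big|>\varepsilon c_aE\Big)\le\exp\Big(-c\frac{E}{|\log E|^3}N\Big).$$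
   Context: $\mathbb T=\mathbb R/\mathbb Z$; $\mathbb P$ is Lebesgue measure on $\mathbb T$ and $\mathbb E[f]=\int_{\mathbb T}f(x)\,dx$. For $x\in\mathbb T$, $n\in\mathbb Z_{\ge0}$ put $a_n=a_n(x)=a(2^n x \bmod 1)$. For $E\in\mathbb R$ the transfer matrices are $T_0^E=\mathrm{Id}$ and, for $n\ge1$, $$T_n^E(x)=A_{n-1}^E\cdots A_0^E,\qquad A_j^E=\frac1{a_j}\begin{pmatrix}a_{j+1}+a_j-E&-a_j^2\\1&0\end{pmatrix},$$ and $\|\cdot\|$ is the operator norm. The constants $c,E_0,N_0$ may also depend on the fixed function $a$. *)

theory Defs
  imports "HOL-Probability.Probability"
begin

(* The circle R/Z is represented by its fundamental domain [0,1); functions on the circle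
   are 1-periodic functions on the reals. *)
definition circle :: "real measure" where
  "circle = lebesgue_on {0..<1}"

(* C^1 functions on the circle: the derivative is two-sided everywhere, including at integers. *)
definition C1_circle :: "(real \<Rightarrow> real) \<Rightarrow> bool" where
  "C1_circle a \<longleftrightarrow> (\<forall>x. a (x + 1) = a x) \<and> a C1_differentiable_on UNIV"

definition orbit_seq :: "(real \<Rightarrow> real) \<Rightarrow> nat \<Rightarrow> real \<Rightarrow> real" where
  "orbit_seq a n x = a (frac (2 ^ n * x))"

definition step_matrix :: "(real \<Rightarrow> real) \<Rightarrow> real \<Rightarrow> nat \<Rightarrow> real \<Rightarrow> real^2^2" where
  "step_matrix a E j x = (1 / orbit_seq a j x) *\<^sub>R
     vector [vector [orbit_seq a (Suc j) x + orbit_seq a j x - E, - (orbit_seq a j x)\<^sup>2],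
             vector [1, 0]]"

primrec transfer_matrix :: "(real \<Rightarrow> real) \<Rightarrow> real \<Rightarrow> nat \<Rightarrow> real \<Rightarrow> real^2^2" where
  "transfer_matrix a E 0 x = mat 1"
| "transfer_matrix a E (Suc n) x = step_matrix a E n x ** transfer_matrix a E n x"

definition kappa :: "(real \<Rightarrow> real) \<Rightarrow> real" where
  "kappa a = inverse (LINT x|circle. inverse (a x))"

definition q_fun :: "(real \<Rightarrow> real) \<Rightarrow> real \<Rightarrow> real" where
  "q_fun a x = inverse (kappa a) - inverse (a x)"

(* The series over s >= 1 is indexed from 0, with s replaced by Suc s. *)
definition c_coeff :: "(real \<Rightarrow> real) \<Rightarrow> real" where
  "c_coeff a = kappa a / 8 *
     ((LINT x|circle. (q_fun a x)\<^sup>2)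
      + 2 * (\<Sum>s. LINT x|circle. q_fun a x * q_fun a (2 ^ Suc s * x)))"

end

(*
Time reversal turns the deterministic cocycle into a Markovian one: if x is uniform and y_k =
2^(N-k) x mod 1, then y_(k+1) is one of the two preimages of y_k under doubling, each with
probability 1/2, and the transpose of the matrix product is driven forward by y_1, ..., y_N. In the
variables (psi_(j-1), p_j) with p_j = a_j * (psi_j - psi_(j-1)), where p_j is divided by sqrt (E
kappa), a step is a rotation by about delta = sqrt (E / kappa) perturbed by delta * r with r = kappa
* q. Let rho + i phi be the complex logarithm of a row of the product. Adding to rho a bounded
corrector of size O(delta), built from solutions of Poisson equations for the doubling map (they
exist since the transfer operator contracts Lipschitz constants) and from the averaging of the slow
phase phi, makes its conditional increment equal to delta^2 * gamma + O(delta^3), where gamma *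
delta^2 = c_a * E. The increments being O(delta), exponential moments and Markov's inequality give
the bound exp (- c E N), which is stronger than the one claimed.
*)
theory Submission
  imports Defs
begin

section \<open>The transfer operator of the doubling map\<close>

text \<open>The drift to be detected has size \<open>\<delta>\<^sup>2\<close> per step, but the
  increment of \<rho> contains \<open>- \<delta> * r * sin (2 * \<phi>) / 2\<close>, of order
  \<delta> and not conditionally centred, since the mean of \<open>r\<close> over two preimages need
  not vanish. A Poisson solution \<open>G\<close> of \<open>r\<close> removes this term. As the
  phase moves by about \<delta> between the old and the new value of that correction, terms of order
  \<open>\<delta>\<^sup>2\<close> appear, among them \<open>r * G\<close>. Hence three Poisson
  solutions: \<open>G\<close> for \<open>r\<close>, \<open>K\<close> for \<open>G\<close>, and
  \<open>J\<close> for \<open>r\<^sup>2 / 2 + r * G - 4 * \<gamma>\<close>. The limit constant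
  originates here: \<open>4 * \<gamma>\<close> is the mean of \<open>r\<^sup>2 / 2 + r * G\<close>,
  in which the mean of \<open>r * G\<close> is the correlation series of c_a, and
  \<open>(cos \<phi>)\<^sup>2 * cos (2 * \<phi>)\<close> has phase average 1/4. No equidistribution
  of the phase is proved: what depends on the phase alone is \<open>\<delta>\<^sup>2\<close> times
  the derivative of a periodic function along a phase of speed about \<delta>, so it telescopes up
  to order \<open>\<delta> ^ 3\<close> and martingale terms.\<close>

definition doubling_op :: "(real \<Rightarrow> real) \<Rightarrow> real \<Rightarrow> real" where
  "doubling_op f y = (f (y / 2) + f ((y + 1) / 2)) / 2"

text \<open>Functions on the circle stay periodic functions on the whole line, so
  \<open>y / 2\<close>, \<open>(y + 1) / 2\<close> and \<open>2 * x\<close> need no reduction mod 1.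
  The class is preserved by products and by inverses of functions bounded below, and the transfer
  operator halves its constant.\<close>

definition circle_lipschitz :: "real \<Rightarrow> (real \<Rightarrow> real) \<Rightarrow> bool" where
  "circle_lipschitz C f \<longleftrightarrow> C-lipschitz_on UNIV f \<and> (\<forall>x. f (x + 1) = f x)"

lemma circle_lipschitz_continuous: "circle_lipschitz C f \<Longrightarrow> continuous_on S f"
  unfolding circle_lipschitz_def
  using lipschitz_on_continuous_on continuous_on_subset by blast

lemma circle_lipschitzD: "circle_lipschitz C f \<Longrightarrow> \<bar>f x - f y\<bar> \<le> C * \<bar>x - y\<bar>"
  unfolding circle_lipschitz_def lipschitz_on_def by (auto simp: dist_real_def)

lemma circle_lipschitz_nonneg: "circle_lipschitz C f \<Longrightarrow> 0 \<le> C"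
  unfolding circle_lipschitz_def lipschitz_on_def by auto

lemma periodic_add_of_nat:
  fixes f :: "real \<Rightarrow> 'a"
  assumes "\<And>x. f (x + 1) = f x"
  shows "f (x + of_nat n) = f x"
proof (induction n)
  case (Suc n)
  then show ?case using assms[of "x + of_nat n"] by (simp add: algebra_simps)
qed simp

lemma periodic_add_of_int:
  fixes f :: "real \<Rightarrow> 'a"
  assumes "\<And>x. f (x + 1) = f x"
  shows "f (x + of_int n) = f x"
proof (cases "n \<ge> 0")
  case True
  then show ?thesis using periodic_add_of_nat[of f x "nat n"] assms by simp
next
  case False
  then show ?thesis using periodic_add_of_nat[of f "x + of_int n" "nat (- n)"] assms by simp
qed

lemma periodic_frac:
  fixes f :: "real \<Rightarrow> 'a"
  assumes "\<And>x. f (x + 1) = f x"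
  shows "f (frac x) = f x"
  using periodic_add_of_int[of f "frac x" "\<lfloor>x\<rfloor>", OF assms] by (simp add: frac_def)

lemma doubling_op_continuous:
  assumes "continuous_on UNIV f"
  shows "continuous_on UNIV (doubling_op f)"
  unfolding doubling_op_def
  by (intro continuous_intros continuous_on_compose2[OF assms]) auto

text \<open>Each inverse branch maps the unit interval affinely onto one half of it with slope 1/2.
  In probabilistic terms, a fair choice between the preimages of a uniform point is again
  uniform.\<close>

lemma integral_doubling_op:
  assumes f: "continuous_on {0..1} f"
  shows "integral {0..1} (doubling_op f) = integral {0..1} f"
proof -
  have i1: "f integrable_on {0..1/2}" and i2: "f integrable_on {1/2..1}"
    by (intro integrable_continuous_real continuous_on_subset[OF f]; auto)+
  have "((\<lambda>x. f ((1/2) *\<^sub>R x + 0)) has_integral (integral {0..1/2} f /\<^sub>R (1/2) ^ DIM(real)))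
      (cbox ((0 - 0) /\<^sub>R (1/2)) ((1/2 - 0) /\<^sub>R (1/2)))"
    using i1 by (intro has_integral_affinity') (auto simp: has_integral_integral)
  moreover have "((\<lambda>x. f ((1/2) *\<^sub>R x + 1/2)) has_integral (integral {1/2..1} f /\<^sub>R (1/2) ^ DIM(real)))
      (cbox ((1/2 - 1/2) /\<^sub>R (1/2)) ((1 - 1/2) /\<^sub>R (1/2)))"
    using i2 by (intro has_integral_affinity') (auto simp: has_integral_integral)
  ultimately have "((\<lambda>x. (f (x / 2) + f (x / 2 + 1 / 2)) / 2) has_integral
      (integral {0..1/2} f * 2 + integral {1/2..1} f * 2) / 2) {0..1}"
    by (intro has_integral_divide has_integral_add) (simp_all add: mult.commute)
  then have "integral {0..1} (doubling_op f) = integral {0..1/2} f + integral {1/2..1} f"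
    unfolding doubling_op_def by (auto dest!: integral_unique simp: add_divide_distrib)
  also have "\<dots> = integral {0..1} f"
    by (intro Henstock_Kurzweil_Integration.integral_combine) (auto intro: integrable_continuous_real f)
  finally show ?thesis .
qed

text \<open>Both inverse branches contract distances by 1/2, and shifting \<open>y\<close> by 1
  interchanges them up to a full period.\<close>

lemma circle_lipschitz_doubling_op:
  assumes "circle_lipschitz C f"
  shows "circle_lipschitz (C / 2) (doubling_op f)"
proof -
  have "\<bar>doubling_op f x - doubling_op f y\<bar> \<le> C / 2 * \<bar>x - y\<bar>" for x y
  proof -
    have "\<bar>f (x / 2) - f (y / 2)\<bar> \<le> C * \<bar>x / 2 - y / 2\<bar>"
      and "\<bar>f ((x + 1) / 2) - f ((y + 1) / 2)\<bar> \<le> C * \<bar>(x + 1) / 2 - (y + 1) / 2\<bar>"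
      by (rule circle_lipschitzD[OF assms])+
    moreover have "\<bar>x / 2 - y / 2\<bar> = \<bar>x - y\<bar> / 2" "\<bar>(x + 1) / 2 - (y + 1) / 2\<bar> = \<bar>x - y\<bar> / 2"
      by (auto simp: abs_if field_simps)
    ultimately have "\<bar>f (x / 2) - f (y / 2)\<bar> \<le> C * \<bar>x - y\<bar> / 2"
      and "\<bar>f ((x + 1) / 2) - f ((y + 1) / 2)\<bar> \<le> C * \<bar>x - y\<bar> / 2" by simp_all
    then show ?thesis unfolding doubling_op_def by argo
  qed
  moreover have "doubling_op f (x + 1) = doubling_op f x" for x
  proof -
    have "f (x / 2 + 1) = f (x / 2)" using assms by (auto simp: circle_lipschitz_def)
    moreover have "(x + 1 + 1) / 2 = x / 2 + 1" by simp
    ultimately show ?thesis unfolding doubling_op_def by (metis add.commute)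
  qed
  ultimately show ?thesis using circle_lipschitz_nonneg[OF assms]
    by (auto simp: circle_lipschitz_def lipschitz_on_def dist_real_def)
qed

text \<open>Over a unit interval the function stays within \<open>C\<close> of any one of its
  values, and therefore so does its mean, which is 0.\<close>

lemma circle_lipschitz_mean_zero_bound:
  assumes f: "circle_lipschitz C f" and "integral {0..1} f = 0"
  shows "\<bar>f x\<bar> \<le> C"
proof -
  have int: "f integrable_on {0..1}"
    by (intro integrable_continuous_real circle_lipschitz_continuous[OF f])
  define y where "y = frac x"
  have y: "0 \<le> y" "y \<le> 1" unfolding y_def using frac_lt_1[of x] by auto
  have near: "\<bar>f t - f y\<bar> \<le> C" if "t \<in> {0..1}" for t
  proof -
    have "C * \<bar>t - y\<bar> \<le> C * 1"
      using that y circle_lipschitz_nonneg[OF f] by (intro mult_left_mono) auto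
    then show ?thesis using circle_lipschitzD[OF f, of t y] by simp
  qed
  have upper: "f t \<le> f y + C" and lower: "f y - C \<le> f t" if "t \<in> {0..1}" for t
    using near[OF that] by linarith+
  have "integral {0..1} f \<le> integral {0..1::real} (\<lambda>t. f y + C)"
    by (rule Henstock_Kurzweil_Integration.integral_le[OF int integrable_const_ivl upper])
  moreover have "integral {0..1::real} (\<lambda>t. f y - C) \<le> integral {0..1} f"
    by (rule Henstock_Kurzweil_Integration.integral_le[OF integrable_const_ivl int lower])
  ultimately have "\<bar>f y\<bar> \<le> C" using assms by auto
  then show ?thesis using periodic_frac[of f x] f by (auto simp: y_def circle_lipschitz_def)
qed

lemma circle_lipschitz_doubling_op_power:
  assumes "circle_lipschitz C f"
  shows "circle_lipschitz (C / 2 ^ s) ((doubling_op ^^ s) f)"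
  by (induction s) (use assms circle_lipschitz_doubling_op in \<open>force simp: mult.commute\<close>)+

lemma integral_doubling_op_power:
  assumes "circle_lipschitz C f"
  shows "integral {0..1} ((doubling_op ^^ s) f) = integral {0..1} f"
  by (induction s)
    (auto simp: integral_doubling_op circle_lipschitz_continuous[OF circle_lipschitz_doubling_op_power[OF assms]])

text \<open>Exponential decay of correlations in its simplest form: the iterates keep mean zero
  while their Lipschitz constants halve. It makes every Poisson series below converge
  geometrically.\<close>

lemma doubling_op_power_bound:
  assumes "circle_lipschitz C f" and "integral {0..1} f = 0"
  shows "\<bar>(doubling_op ^^ s) f y\<bar> \<le> C / 2 ^ s"
  using circle_lipschitz_mean_zero_bound[OF circle_lipschitz_doubling_op_power[OF assms(1)]]
    integral_doubling_op_power[OF assms(1)] assms(2) by simp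

text \<open>Each induction step strips one doubling off \<open>g\<close>: a factor composed with the
  doubling map is equal at both preimages of a point, so it can be pulled out of the transfer
  operator, which leaves the mean unchanged.\<close>

lemma integral_doubling_duality:
  assumes f: "continuous_on UNIV f" and g: "continuous_on UNIV g" "\<And>x. g (x + 1) = g x"
  shows "integral {0..1} (\<lambda>x. f x * g (2 ^ s * x)) = integral {0..1} (\<lambda>x. (doubling_op ^^ s) f x * g x)"
  using f
proof (induction s arbitrary: f)
  case (Suc s)
  have per: "g (2 ^ s * x + 2 ^ s) = g (2 ^ s * x)" for x
    using periodic_add_of_nat[of g "2 ^ s * x" "2 ^ s"] g(2) by simp
  have "integral {0..1} (\<lambda>x. f x * g (2 ^ Suc s * x)) =
      integral {0..1} (doubling_op (\<lambda>x. f x * g (2 ^ Suc s * x)))"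
    by (intro integral_doubling_op[symmetric] continuous_intros continuous_on_compose2[OF g(1)]
        continuous_on_subset[OF Suc.prems]) auto
  also have "doubling_op (\<lambda>x. f x * g (2 ^ Suc s * x)) = (\<lambda>x. doubling_op f x * g (2 ^ s * x))"
    using per by (auto simp: fun_eq_iff doubling_op_def ring_distribs add_divide_distrib)
  also have "integral {0..1} \<dots> = integral {0..1} (\<lambda>x. (doubling_op ^^ s) (doubling_op f) x * g x)"
    by (intro Suc.IH doubling_op_continuous Suc.prems)
  finally show ?case by (simp add: funpow_Suc_right del: funpow.simps)
qed simp

section \<open>Poisson equations and the correlation series\<close>

definition poisson :: "(real \<Rightarrow> real) \<Rightarrow> real \<Rightarrow> real" where
  "poisson f y = (\<Sum>s. (doubling_op ^^ Suc s) f y)"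

lemma summable_doubling_op_power:
  assumes "circle_lipschitz C f" and "integral {0..1} f = 0"
  shows "summable (\<lambda>s. (doubling_op ^^ s) f y)"
proof (rule summable_comparison_test')
  show "summable (\<lambda>s. C * (1 / 2) ^ s)" by (intro summable_mult summable_geometric) auto
qed (use doubling_op_power_bound[OF assms] in \<open>auto simp: power_divide\<close>)

text \<open>The series begins with the first iterate because the chain moves to a preimage
  \<open>x\<close> of \<open>y\<close> and \<open>f\<close> is evaluated at the new point. With this
  convention \<open>f x + poisson f x - poisson f y\<close> averages to zero over the two preimages
  \<open>x\<close> of \<open>y\<close>.\<close>

lemma poisson_equation:
  assumes "circle_lipschitz C f" and "integral {0..1} f = 0"
  shows "doubling_op (\<lambda>x. f x + poisson f x) y = poisson f y"
proof -
  have sm: "summable (\<lambda>s. (doubling_op ^^ s) f x)" for x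
    by (rule summable_doubling_op_power[OF assms])
  have "f x + poisson f x = (\<Sum>s. (doubling_op ^^ s) f x)" for x
    unfolding poisson_def using suminf_split_head[OF sm[of x]] by simp
  then have "doubling_op (\<lambda>x. f x + poisson f x) y =
     ((\<Sum>s. (doubling_op ^^ s) f (y / 2)) + (\<Sum>s. (doubling_op ^^ s) f ((y + 1) / 2))) / 2"
    by (simp add: doubling_op_def)
  also have "\<dots> = (\<Sum>s. ((doubling_op ^^ s) f (y / 2) + (doubling_op ^^ s) f ((y + 1) / 2)) / 2)"
    by (simp add: suminf_add[OF sm sm] suminf_divide[OF summable_add[OF sm sm]])
  also have "\<dots> = poisson f y" by (simp add: poisson_def doubling_op_def)
  finally show ?thesis .
qed

text \<open>The constants \<open>C / 2 ^ s\<close> with \<open>s\<close> at least 1 sum to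
  \<open>C\<close>, so the solution is no rougher than the right-hand side and can itself serve as a
  right-hand side.\<close>

lemma circle_lipschitz_poisson:
  assumes f: "circle_lipschitz C f" "integral {0..1} f = 0"
  shows "circle_lipschitz C (poisson f)"
proof -
  have sm: "summable (\<lambda>s. (doubling_op ^^ Suc s) f x)" for x
    using summable_doubling_op_power[OF assms] by (subst summable_Suc_iff)
  have half: "(\<lambda>s. D * (1 / 2) ^ Suc s) sums D" for D :: real
    using sums_mult[OF power_half_series, of D] by simp
  have "\<bar>poisson f x - poisson f y\<bar> \<le> C * \<bar>x - y\<bar>" for x y
  proof -
    have "norm (\<Sum>s. (doubling_op ^^ Suc s) f x - (doubling_op ^^ Suc s) f y)
        \<le> (\<Sum>s. (C * \<bar>x - y\<bar>) * (1 / 2) ^ Suc s)"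
    proof (rule norm_suminf_le)
      fix s
      show "norm ((doubling_op ^^ Suc s) f x - (doubling_op ^^ Suc s) f y) \<le> (C * \<bar>x - y\<bar>) * (1 / 2) ^ Suc s"
        using circle_lipschitzD[OF circle_lipschitz_doubling_op_power[OF f(1), of "Suc s"], of x y]
        by (simp add: power_divide field_simps)
    qed (rule sums_summable[OF half])
    then show ?thesis using sums_unique[OF half[of "C * \<bar>x - y\<bar>"]]
      by (simp add: poisson_def suminf_diff[OF sm sm] del: funpow.simps)
  qed
  moreover have "poisson f (x + 1) = poisson f x" for x
    using circle_lipschitz_doubling_op_power[OF f(1)]
    by (simp add: poisson_def circle_lipschitz_def del: funpow.simps)
  ultimately show ?thesis using circle_lipschitz_nonneg[OF f(1)]
    by (auto simp: circle_lipschitz_def lipschitz_on_def dist_real_def)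
qed

text \<open>Termwise integration, justified by the geometric majorant. It is used with the constant
  1 for the mean of a Poisson solution and with \<open>f\<close> itself for the
  correlations.\<close>

lemma integral_poisson_mult:
  assumes f: "circle_lipschitz C f" "integral {0..1} f = 0"
    and g: "continuous_on {0..1} g"
  shows "(\<lambda>s. integral {0..1} (\<lambda>x. (doubling_op ^^ Suc s) f x * g x)) sums
    integral {0..1} (\<lambda>x. poisson f x * g x)"
proof -
  obtain B where B: "\<And>x. x \<in> {0..1} \<Longrightarrow> \<bar>g x\<bar> \<le> B"
    using compact_imp_bounded[OF compact_continuous_image[OF g compact_Icc]]
    by (force simp: bounded_iff)
  have C: "0 \<le> C" by (rule circle_lipschitz_nonneg[OF f(1)])
  define h where "h = (\<lambda>s x. (doubling_op ^^ Suc s) f x * g x)"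
  have cont: "continuous_on {0..1} (h s)" for s
    unfolding h_def
    by (intro continuous_intros g circle_lipschitz_continuous[OF circle_lipschitz_doubling_op_power[OF f(1)]])
  have "uniform_limit {0..1} (\<lambda>n x. \<Sum>s<n. h s x) (\<lambda>x. \<Sum>s. h s x) sequentially"
  proof (rule Weierstrass_m_test)
    fix s x assume x: "x \<in> {0..1::real}"
    have "\<bar>(doubling_op ^^ Suc s) f x\<bar> * \<bar>g x\<bar> \<le> (C / 2 ^ Suc s) * B"
      using C B[OF x] by (intro mult_mono doubling_op_power_bound f) auto
    then show "norm (h s x) \<le> C * B / 2 * (1 / 2) ^ s"
      by (simp add: h_def abs_mult power_divide del: funpow.simps)
  next
    show "summable (\<lambda>s. C * B / 2 * (1 / 2) ^ s)" by (intro summable_mult summable_geometric) auto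
  qed
  then obtain I J where I: "\<And>n. ((\<lambda>x. \<Sum>s<n. h s x) has_integral I n) {0..1}"
    and J: "((\<lambda>x. \<Sum>s. h s x) has_integral J) {0..1}" and IJ: "I \<longlonglongrightarrow> J"
    by (rule uniform_limit_integral) (auto intro: continuous_on_sum cont)
  have "I n = (\<Sum>s<n. integral {0..1} (h s))" for n
    using integral_unique[OF I[of n]]
    by (subst (asm) integral_sum) (auto intro: integrable_continuous_real cont)
  then have "(\<lambda>s. integral {0..1} (h s)) sums J" using IJ unfolding sums_def by presburger
  moreover have "(\<Sum>s. h s x) = poisson f x * g x" for x
    unfolding h_def poisson_def
    using summable_doubling_op_power[OF f] by (intro suminf_mult2[symmetric]) (subst summable_Suc_iff)
  then have "J = integral {0..1} (\<lambda>x. poisson f x * g x)" using integral_unique[OF J] by simp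
  ultimately show ?thesis by (simp add: h_def)
qed

lemma integral_poisson:
  assumes f: "circle_lipschitz C f" "integral {0..1} f = 0"
  shows "integral {0..1} (poisson f) = 0"
proof -
  have "(\<lambda>s. 0) sums integral {0..1} (poisson f)"
    using integral_poisson_mult[OF f, of "\<lambda>_. 1"] integral_doubling_op_power[OF f(1)] f(2)
    by (simp del: funpow.simps)
  then show ?thesis using sums_unique2[OF _ sums_zero] by blast
qed

text \<open>By duality the correlations of \<open>f\<close> with its compositions are integrals of
  iterates against \<open>f\<close>. This identifies the series in c_a with the mean of
  \<open>f * poisson f\<close>, which is the quantity that the second-order expansion
  produces.\<close>

lemma integral_mult_poisson:
  assumes f: "circle_lipschitz C f" "integral {0..1} f = 0"
  shows "(\<lambda>s. integral {0..1} (\<lambda>x. f x * f (2 ^ Suc s * x))) sums integral {0..1} (\<lambda>x. f x * poisson f x)"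
proof -
  have c: "continuous_on S f" for S by (rule circle_lipschitz_continuous[OF f(1)])
  have "integral {0..1} (\<lambda>x. f x * f (2 ^ Suc s * x)) =
      integral {0..1} (\<lambda>x. (doubling_op ^^ Suc s) f x * f x)" for s
    using f(1) by (intro integral_doubling_duality c) (auto simp: circle_lipschitz_def)
  then show ?thesis using integral_poisson_mult[OF f c] by (simp add: mult.commute del: funpow.simps power_Suc)
qed

lemma circle_lipschitz_bounded:
  assumes "circle_lipschitz C f" shows "\<exists>M. \<forall>x. \<bar>f x\<bar> \<le> M"
proof -
  have "\<bar>f x\<bar> \<le> \<bar>f 0\<bar> + C" for x
  proof -
    have "\<bar>f (frac x) - f 0\<bar> \<le> C * \<bar>frac x - 0\<bar>" by (rule circle_lipschitzD[OF assms])
    also have "\<dots> \<le> C * 1"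
      using circle_lipschitz_nonneg[OF assms] frac_lt_1[of x] by (intro mult_left_mono) auto
    finally show ?thesis using periodic_frac[of f x] assms by (auto simp: circle_lipschitz_def)
  qed
  then show ?thesis by blast
qed

lemma circle_lipschitz_mult:
  assumes f: "circle_lipschitz C f" and g: "circle_lipschitz D g"
  shows "\<exists>C. circle_lipschitz C (\<lambda>x. f x * g x)"
proof -
  obtain M N where M: "\<And>x. \<bar>f x\<bar> \<le> M" and N: "\<And>x. \<bar>g x\<bar> \<le> N"
    using circle_lipschitz_bounded[OF f] circle_lipschitz_bounded[OF g] by blast
  have "0 \<le> M" "0 \<le> N" using M[of 0] N[of 0] by auto
  have "\<bar>f x * g x - f y * g y\<bar> \<le> (M * D + C * N) * \<bar>x - y\<bar>" for x y
  proof -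
    have "f x * g x - f y * g y = f x * (g x - g y) + (f x - f y) * g y" by (simp add: algebra_simps)
    also have "\<bar>\<dots>\<bar> \<le> \<bar>f x\<bar> * \<bar>g x - g y\<bar> + \<bar>f x - f y\<bar> * \<bar>g y\<bar>"
      by (metis abs_mult abs_triangle_ineq)
    also have "\<dots> \<le> M * (D * \<bar>x - y\<bar>) + (C * \<bar>x - y\<bar>) * N"
      using \<open>0 \<le> M\<close> circle_lipschitz_nonneg[OF f]
      by (intro add_mono mult_mono M N circle_lipschitzD[OF f] circle_lipschitzD[OF g]) auto
    finally show ?thesis by (simp add: algebra_simps)
  qed
  moreover have "0 \<le> M * D + C * N"
    using \<open>0 \<le> M\<close> \<open>0 \<le> N\<close> circle_lipschitz_nonneg[OF f] circle_lipschitz_nonneg[OF g] by simp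
  ultimately have "circle_lipschitz (M * D + C * N) (\<lambda>x. f x * g x)"
    using f g by (auto simp: circle_lipschitz_def lipschitz_on_def dist_real_def)
  then show ?thesis by blast
qed

lemma circle_lipschitz_add:
  "circle_lipschitz C f \<Longrightarrow> circle_lipschitz D g \<Longrightarrow> circle_lipschitz (C + D) (\<lambda>x. f x + g x)"
  unfolding circle_lipschitz_def by (auto intro: lipschitz_on_add)

section \<open>Expansion of one logarithmic step\<close>

text \<open>On the disc of radius 1/2 the argument avoids the branch cut and the third derivative
  \<open>2 / (1 + z) ^ 3\<close> has modulus at most 16. The Taylor estimate divides by
  \<open>fact 2\<close>, whence 8.\<close>

lemma Ln_one_plus_quadratic_approx:
  assumes "cmod w \<le> 1 / 2"
  shows "cmod (Ln (1 + w) - (w - w\<^sup>2 / 2)) \<le> 8 * cmod w ^ 3"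
proof -
  define S where "S = cball (0::complex) (1 / 2)"
  have far: "1 / 2 \<le> cmod (1 + z)" and nonpos: "1 + z \<notin> \<real>\<^sub>\<le>\<^sub>0" if "z \<in> S" for z
  proof -
    have "cmod z \<le> 1 / 2" using that by (simp add: S_def)
    then show "1 / 2 \<le> cmod (1 + z)" using norm_diff_ineq[of 1 z] by simp
    have "- Re z \<le> 1 / 2" using \<open>cmod z \<le> 1 / 2\<close> abs_Re_le_cmod[of z] by linarith
    then show "1 + z \<notin> \<real>\<^sub>\<le>\<^sub>0" by (auto simp: complex_nonpos_Reals_iff)
  qed
  define f where "f = (\<lambda>(i::nat) z. if i = 0 then Ln (1 + z) else if i = 1 then inverse (1 + z)
     else if i = 2 then - inverse ((1 + z)\<^sup>2) else 2 * inverse ((1 + z) ^ 3) :: complex)"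

  have "cmod (f 0 w - (\<Sum>i\<le>2. f i 0 * (w - 0) ^ i / fact i)) \<le> 16 * cmod (w - 0) ^ Suc 2 / fact 2"
  proof (rule complex_Taylor)
    fix i :: nat and z assume z: "z \<in> S" and "i \<le> 2"
    have nz: "1 + z \<noteq> 0" using far[OF z] by auto
    consider "i = 0" | "i = 1" | "i = 2" using \<open>i \<le> 2\<close> by linarith
    then show "(f i has_field_derivative f (Suc i) z) (at z within S)"
    proof cases
      case 1
      then show ?thesis using nonpos[OF z] unfolding f_def
        by (auto intro!: derivative_eq_intros simp: field_simps)
    next
      case 2
      then show ?thesis using nz unfolding f_def
        by (auto intro!: derivative_eq_intros simp: field_simps power2_eq_square)
    next
      case 3
      have "((\<lambda>z. (1 + z)\<^sup>2) has_field_derivative 2 * (1 + z)) (at z within S)"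
        by (auto intro!: derivative_eq_intros)
      then have "((\<lambda>z. - inverse ((1 + z)\<^sup>2)) has_field_derivative
          - (- (inverse ((1 + z)\<^sup>2) * (2 * (1 + z)) * inverse ((1 + z)\<^sup>2)))) (at z within S)"
        using nz by (intro DERIV_minus DERIV_inverse') auto
      moreover have eq: "- (- (inverse (y\<^sup>2) * (2 * y) * inverse (y\<^sup>2))) = 2 * inverse (y ^ 3)" for y :: complex
        by (cases "y = 0") (auto simp: field_simps power2_eq_square power3_eq_cube)
      ultimately have "((\<lambda>z. - inverse ((1 + z)\<^sup>2)) has_field_derivative 2 * inverse ((1 + z) ^ 3)) (at z within S)"
        by (simp only: eq)
      then show ?thesis using 3 by (simp add: f_def)
    qed
  next
    fix z assume z: "z \<in> S"
    have "(1 / 2) ^ 3 \<le> cmod (1 + z) ^ 3" using far[OF z] by (intro power_mono) auto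
    then have "inverse (cmod (1 + z) ^ 3) \<le> inverse ((1 / 2) ^ 3)" by (intro le_imp_inverse_le) auto
    then show "cmod (f (Suc 2) z) \<le> 16" by (simp add: f_def norm_mult norm_inverse norm_power power_divide)
  qed (use assms in \<open>auto simp: S_def\<close>)
  then show ?thesis by (simp add: f_def numeral_2_eq_2 numeral_3_eq_3 algebra_simps)
qed

text \<open>If \<open>X + i Y = exp (\<rho> + i \<phi>)\<close>, then multiplying the row \<open>(X, Y)\<close> by the rescaled one-step
  matrix (\<open>phase_matrix\<close> below) multiplies \<open>X + i Y\<close> by \<open>1 + log_increment \<delta> r \<phi>\<close>.\<close>

definition log_increment :: "real \<Rightarrow> real \<Rightarrow> real \<Rightarrow> complex" where
  "log_increment \<delta> r \<phi> = Complex
     (- \<delta> * r * cos \<phi> * sin \<phi> - \<delta>\<^sup>2 * (1 - r) * (sin \<phi>)\<^sup>2)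
     (\<delta> * (1 - r * (cos \<phi>)\<^sup>2) - \<delta>\<^sup>2 * (1 - r) * sin \<phi> * cos \<phi>)"

text \<open>The real part is needed to second order, since the drift lives there. The phase is
  needed only to first order, because it acts through correctors that carry a factor \<delta>. The
  increment has modulus at most \<open>7 * M * \<delta>\<close>, so the threshold
  \<open>1 / (14 * M)\<close> keeps it below 1/2; 2800 rounds up 8 * 7^3 + 20.\<close>

lemma log_increment_expansion:
  assumes M: "1 \<le> M" "\<bar>r\<bar> \<le> M" and \<delta>: "0 < \<delta>" "\<delta> \<le> 1 / (14 * M)"
  shows "cmod (log_increment \<delta> r \<phi>) \<le> 1 / 2"
    and "\<bar>Re (Ln (1 + log_increment \<delta> r \<phi>)) - (- \<delta> * r * (cos \<phi> * sin \<phi>)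
         + \<delta>\<^sup>2 * (cos (2 * \<phi>) / 2 - r * cos (2 * \<phi>) + r\<^sup>2 / 2 * ((cos \<phi>)\<^sup>2 * cos (2 * \<phi>))))\<bar> \<le> 2800 * M ^ 3 * \<delta> ^ 3"
    and "\<bar>Im (Ln (1 + log_increment \<delta> r \<phi>)) - \<delta> * (1 - r * (cos \<phi>)\<^sup>2)\<bar> \<le> 2800 * M ^ 3 * \<delta>\<^sup>2"
proof -
  define c s where "c = cos \<phi>" and "s = sin \<phi>"
  have cs: "\<bar>c\<bar> \<le> 1" "\<bar>s\<bar> \<le> 1" and s2: "s\<^sup>2 = 1 - c\<^sup>2" by (auto simp: c_def s_def sin_squared_eq)
  have c2: "cos (2 * \<phi>) = 2 * c\<^sup>2 - 1" by (simp add: c_def cos_double_cos)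
  \<comment> \<open>The coefficients of \<delta> and \<open>\<delta>\<^sup>2\<close> in the
    increment. The logarithm is then
    \<open>\<delta> * u + \<delta>\<^sup>2 * (v - u\<^sup>2 / 2)\<close> up to third order.\<close>
  define u v where "u = Complex (- r * c * s) (1 - r * c\<^sup>2)"
    and "v = Complex (- (1 - r) * s\<^sup>2) (- (1 - r) * s * c)"
  define w where "w = log_increment \<delta> r \<phi>"
  have w: "w = \<delta> * u + \<delta>\<^sup>2 * v"
    by (auto simp: w_def u_def v_def log_increment_def complex_eq_iff c_def s_def algebra_simps simp flip: of_real_power)
  have ss: "\<bar>c * s\<bar> \<le> 1" "\<bar>c\<^sup>2\<bar> \<le> 1" "\<bar>s\<^sup>2\<bar> \<le> 1" "\<bar>s * c\<bar> \<le> 1"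
    using cs mult_le_one[of "\<bar>c\<bar>" "\<bar>s\<bar>"] by (auto simp: abs_mult abs_square_le_1 mult.commute)
  have "\<bar>r * (c * s)\<bar> \<le> M * 1" "\<bar>r * c\<^sup>2\<bar> \<le> M * 1"
    unfolding abs_mult[of r] using M ss by (intro mult_mono; auto)+
  then have nu: "cmod u \<le> 3 * M" using M cmod_le[of u] by (simp add: u_def mult.assoc)
  have "\<bar>(1 - r) * s\<^sup>2\<bar> \<le> (2 * M) * 1" "\<bar>(1 - r) * (s * c)\<bar> \<le> (2 * M) * 1"
    unfolding abs_mult[of "1 - r"] using M ss by (intro mult_mono; auto)+
  moreover have "cmod v \<le> \<bar>(1 - r) * s\<^sup>2\<bar> + \<bar>(1 - r) * (s * c)\<bar>"
    using cmod_le[of v] by (simp add: v_def mult.assoc abs_mult abs_minus_commute)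
  ultimately have nv: "cmod v \<le> 4 * M" by linarith
  have \<delta>1: "\<delta> \<le> 1" using \<delta> M by (smt (verit) divide_le_eq_1)
  have "cmod w \<le> \<delta> * cmod u + \<delta>\<^sup>2 * cmod v"
    unfolding w using \<delta> norm_triangle_ineq[of "\<delta> * u" "\<delta>\<^sup>2 * v"] by (simp add: norm_mult norm_power)
  also have "\<dots> \<le> \<delta> * (3 * M) + \<delta> * (4 * M)"
    using nu nv \<delta> \<delta>1 by (intro add_mono mult_mono) (auto simp: power2_eq_square mult_le_cancel_left1)
  finally have nw: "cmod w \<le> 7 * M * \<delta>" by simp
  have "\<delta> * (14 * M) \<le> 1" using \<delta> M by (simp add: field_simps)
  then show small: "cmod (log_increment \<delta> r \<phi>) \<le> 1 / 2"
    using nw unfolding w_def by argo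
  define R where "R = Ln (1 + w) - (\<delta> * u + \<delta>\<^sup>2 * (v - u\<^sup>2 / 2))"
  have "R = (Ln (1 + w) - (w - w\<^sup>2 / 2)) - \<delta> ^ 3 * (u * v) - \<delta> ^ 3 * (\<delta> * v\<^sup>2 / 2)"
    unfolding R_def w by (simp add: power2_eq_square power3_eq_cube field_simps)
  then have "cmod R \<le> cmod (Ln (1 + w) - (w - w\<^sup>2 / 2)) + \<delta> ^ 3 * (cmod u * cmod v) + \<delta> ^ 3 * (\<delta> * (cmod v)\<^sup>2 / 2)"
    using \<delta> norm_triangle_ineq4[of "Ln (1 + w) - (w - w\<^sup>2 / 2)" "\<delta> ^ 3 * (u * v)"]
      norm_triangle_ineq4[of "(Ln (1 + w) - (w - w\<^sup>2 / 2)) - \<delta> ^ 3 * (u * v)" "\<delta> ^ 3 * (\<delta> * v\<^sup>2 / 2)"]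
    by (simp add: norm_mult norm_power norm_divide)
  also have "\<dots> \<le> 8 * (7 * M * \<delta>) ^ 3 + \<delta> ^ 3 * ((3 * M) * (4 * M)) + \<delta> ^ 3 * (1 * (4 * M)\<^sup>2 / 2)"
    using \<delta> \<delta>1 M nu nv nw small
    by (intro add_mono mult_mono order.trans[OF Ln_one_plus_quadratic_approx] divide_right_mono power_mono)
      (auto simp: w_def)
  also have "\<dots> = (2744 * M ^ 3 + 20 * M\<^sup>2) * \<delta> ^ 3"
    by (simp add: power2_eq_square power3_eq_cube algebra_simps)
  also have "\<dots> \<le> (2744 * M ^ 3 + 20 * M ^ 3) * \<delta> ^ 3"
    using M \<delta> by (intro mult_right_mono add_mono mult_left_mono power_increasing) auto
  also have "\<dots> \<le> 2800 * M ^ 3 * \<delta> ^ 3" using M \<delta> by simp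
  finally have R: "cmod R \<le> 2800 * M ^ 3 * \<delta> ^ 3" .
  have "Re R = Re (Ln (1 + w)) - (- \<delta> * r * (c * s)
         + \<delta>\<^sup>2 * (cos (2 * \<phi>) / 2 - r * cos (2 * \<phi>) + r\<^sup>2 / 2 * (c\<^sup>2 * cos (2 * \<phi>))))"
  proof -
    have "Re (v - u\<^sup>2 / 2) = cos (2 * \<phi>) / 2 - r * cos (2 * \<phi>) + r\<^sup>2 / 2 * (c\<^sup>2 * cos (2 * \<phi>))"
    proof -
      have "Re (v - u\<^sup>2 / 2) = - (1 - r) * s\<^sup>2 - (r\<^sup>2 * c\<^sup>2 * s\<^sup>2 - (1 - r * c\<^sup>2)\<^sup>2) / 2"
        by (simp add: u_def v_def power2_eq_square)
      then show ?thesis unfolding s2 c2 by (simp add: power2_eq_square field_simps)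
    qed
    then show ?thesis unfolding R_def by (simp add: u_def flip: of_real_power)
  qed
  then show "\<bar>Re (Ln (1 + log_increment \<delta> r \<phi>)) - (- \<delta> * r * (cos \<phi> * sin \<phi>)
         + \<delta>\<^sup>2 * (cos (2 * \<phi>) / 2 - r * cos (2 * \<phi>) + r\<^sup>2 / 2 * ((cos \<phi>)\<^sup>2 * cos (2 * \<phi>))))\<bar> \<le> 2800 * M ^ 3 * \<delta> ^ 3"
    using abs_Re_le_cmod[of R] R by (simp add: w_def c_def s_def)
  have lin: "cmod (Ln (1 + w) - w) \<le> 2 * (cmod w)\<^sup>2"
  proof -
    have "(cmod w)\<^sup>2 / (1 - cmod w) \<le> (cmod w)\<^sup>2 / (1 / 2)"
      using small by (intro divide_left_mono) (auto simp: w_def)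
    then show ?thesis using Ln_approx_linear[of w] small by (simp add: w_def)
  qed
  have eq: "Ln (1 + w) - \<delta> * u = (Ln (1 + w) - w) + \<delta>\<^sup>2 * v" by (simp add: w)
  then have "cmod (Ln (1 + w) - \<delta> * u) \<le> 2 * (cmod w)\<^sup>2 + \<delta>\<^sup>2 * cmod v"
    unfolding eq using lin norm_triangle_ineq[of "Ln (1 + w) - w" "\<delta>\<^sup>2 * v"] by (simp add: norm_mult norm_power)
  also have "\<dots> \<le> 2 * (7 * M * \<delta>)\<^sup>2 + \<delta>\<^sup>2 * (4 * M)"
    using nv nw by (intro add_mono mult_left_mono power_mono) auto
  also have "\<dots> = (98 * M\<^sup>2 + 4 * M ^ 1) * \<delta>\<^sup>2" by (simp add: power2_eq_square algebra_simps)
  also have "\<dots> \<le> (98 * M ^ 3 + 4 * M ^ 3) * \<delta>\<^sup>2"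
    using M by (intro mult_right_mono add_mono mult_left_mono power_increasing) auto
  also have "\<dots> \<le> 2800 * M ^ 3 * \<delta>\<^sup>2" using M by simp
  finally show "\<bar>Im (Ln (1 + log_increment \<delta> r \<phi>)) - \<delta> * (1 - r * (cos \<phi>)\<^sup>2)\<bar> \<le> 2800 * M ^ 3 * \<delta>\<^sup>2"
    using abs_Im_le_cmod[of "Ln (1 + w) - \<delta> * u"] by (simp add: w_def u_def c_def)
qed

lemma sin_first_order_approx: "\<bar>sin (x + h) - sin x - cos x * h\<bar> \<le> h\<^sup>2" for x h :: real
proof -
  define f where "f = (\<lambda>i::nat. if i = 0 then sin else if i = 1 then cos else (\<lambda>x::real. - sin x) :: real \<Rightarrow> real)"
  have "norm (f 0 (x + h) - (\<Sum>i\<le>1. f i x * (x + h - x) ^ i / fact i)) \<le> 1 * norm (x + h - x) ^ Suc 1 / fact 1"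
  proof (rule field_Taylor[where S = UNIV])
    fix i :: nat and z :: real assume "i \<le> 1"
    then consider "i = 0" | "i = 1" by linarith
    then show "(f i has_field_derivative f (Suc i) z) (at z within UNIV)"
      by cases (auto simp: f_def intro!: derivative_eq_intros)
  qed (auto simp: f_def)
  then show ?thesis by (simp add: f_def power2_eq_square diff_diff_eq)
qed

lemma abs_cos_diff_le: "\<bar>cos (x + h) - cos x\<bar> \<le> \<bar>h\<bar>" for x h :: real
proof -
  have "norm (cos (x + h) - cos x) \<le> 1 * norm (x + h - x)"
    by (rule field_differentiable_bound[of UNIV cos "\<lambda>x. - sin x"])
      (auto intro!: derivative_eq_intros)
  then show ?thesis by simp
qed

section \<open>Correctors\<close>

text \<open>Once \<open>r\<^sup>2 / 2 + r * G\<close> is replaced by its mean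
  \<open>4 * \<gamma>\<close>, the drift of order \<open>\<delta>\<^sup>2\<close> still depends on
  the phase through \<open>cos (2 * \<phi>) / 2 + 4 * \<gamma> * ((cos \<phi>)\<^sup>2 * cos (2 *
  \<phi>))\<close>. Its phase average is \<gamma>, and this function is a periodic antiderivative of
  \<gamma> minus it. As the phase advances by about \<delta>, adding \<open>\<delta>\<close> times
  this function leaves only the average.\<close>

definition phase_mean :: "real \<Rightarrow> real \<Rightarrow> real" where
  "phase_mean \<gamma> \<phi> = - (1 / 4 + \<gamma>) * sin (2 * \<phi>) - \<gamma> / 4 * sin (4 * \<phi>)"

text \<open>The derivative of \<open>phase_mean \<gamma>\<close>, in the form in which it cancels the second-order terms whose
  mean over the phase vanishes.\<close>

definition phase_mean' :: "real \<Rightarrow> real \<Rightarrow> real" where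
  "phase_mean' \<gamma> \<phi> = \<gamma> - 4 * \<gamma> * ((cos \<phi>)\<^sup>2 * cos (2 * \<phi>)) - cos (2 * \<phi>) / 2"

text \<open>The factor multiplying \<open>r\<close> at second order. The first summand comes from
  the radial expansion, the second from the part \<open>- r * (cos \<phi>)\<^sup>2\<close> of the
  phase step, differentiated through \<open>phase_mean\<close>.\<close>

definition phase_lin :: "real \<Rightarrow> real \<Rightarrow> real" where
  "phase_lin \<gamma> \<phi> = - cos (2 * \<phi>) - phase_mean' \<gamma> \<phi> * (cos \<phi>)\<^sup>2"

lemma sin_multiple_approx:
  "\<bar>sin (k * (x + h)) - sin (k * x) - k * cos (k * x) * h\<bar> \<le> k\<^sup>2 * h\<^sup>2" for k x h :: real
  using sin_first_order_approx[of "k * x" "k * h"] by (simp add: algebra_simps)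

lemma cos_multiple_diff_le: "\<bar>cos (k * (x + h)) - cos (k * x)\<bar> \<le> \<bar>k\<bar> * \<bar>h\<bar>" for k x h :: real
  using abs_cos_diff_le[of "k * x" "k * h"] by (simp add: algebra_simps abs_mult)

lemma cos_squared_eq_double: "(cos x)\<^sup>2 = (1 + cos (2 * x)) / 2" for x :: real
  by (simp add: cos_double_cos)

text \<open>The constant Fourier coefficient 1/4 is what turns \<open>4 * \<gamma>\<close> into the
  growth rate \<gamma>.\<close>

lemma cos_squared_mult_cos_double:
  "(cos x)\<^sup>2 * cos (2 * x) = 1 / 4 + cos (2 * x) / 2 + cos (4 * x) / 4" for x :: real
proof -
  have c4: "cos (4 * x) = 2 * (cos (2 * x))\<^sup>2 - 1" using cos_double_cos[of "2 * x"] by simp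
  have "((1 + u) / 2) * u = 1 / 4 + u / 2 + (2 * u\<^sup>2 - 1) / 4" for u :: real
    by (simp add: power2_eq_square field_simps)
  then show ?thesis unfolding c4 cos_squared_eq_double[of x] .
qed

lemma phase_mean_approx:
  "\<bar>phase_mean \<gamma> (x + h) - phase_mean \<gamma> x - phase_mean' \<gamma> x * h\<bar> \<le> 20 * (1 + \<bar>\<gamma>\<bar>) * h\<^sup>2"
proof -
  define A where "A = sin (2 * (x + h)) - sin (2 * x) - 2 * cos (2 * x) * h"
  define B where "B = sin (4 * (x + h)) - sin (4 * x) - 4 * cos (4 * x) * h"
  have A: "\<bar>A\<bar> \<le> 4 * h\<^sup>2" and B: "\<bar>B\<bar> \<le> 16 * h\<^sup>2"
    using sin_multiple_approx[of 2 x h] sin_multiple_approx[of 4 x h] by (auto simp: A_def B_def)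
  have "phase_mean \<gamma> (x + h) - phase_mean \<gamma> x - phase_mean' \<gamma> x * h = - (1 / 4 + \<gamma>) * A - \<gamma> / 4 * B"
    unfolding phase_mean'_def cos_squared_mult_cos_double phase_mean_def A_def B_def
    by (simp add: algebra_simps)
  also have "\<bar>\<dots>\<bar> \<le> \<bar>1 / 4 + \<gamma>\<bar> * \<bar>A\<bar> + \<bar>\<gamma> / 4\<bar> * \<bar>B\<bar>"
    using abs_triangle_ineq4[of "- (1 / 4 + \<gamma>) * A" "\<gamma> / 4 * B"] unfolding abs_mult abs_minus .
  also have "\<dots> \<le> (1 / 4 + \<bar>\<gamma>\<bar>) * (4 * h\<^sup>2) + \<bar>\<gamma> / 4\<bar> * (16 * h\<^sup>2)"
    by (intro add_mono mult_mono A B) auto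
  also have "\<dots> = (1 + 8 * \<bar>\<gamma>\<bar>) * h\<^sup>2" by (simp add: algebra_simps)
  also have "\<dots> \<le> 20 * (1 + \<bar>\<gamma>\<bar>) * h\<^sup>2" by (intro mult_right_mono) auto
  finally show ?thesis .
qed

lemma cos_squared_mult_cos_double_bounds:
  "\<bar>(cos x)\<^sup>2 * cos (2 * x)\<bar> \<le> 1" "\<bar>(cos (x + h))\<^sup>2 * cos (2 * (x + h)) - (cos x)\<^sup>2 * cos (2 * x)\<bar> \<le> 2 * \<bar>h\<bar>"
  for x h :: real
proof -
  show "\<bar>(cos x)\<^sup>2 * cos (2 * x)\<bar> \<le> 1"
    unfolding abs_mult by (intro mult_le_one) (auto simp: abs_square_le_1)
  show "\<bar>(cos (x + h))\<^sup>2 * cos (2 * (x + h)) - (cos x)\<^sup>2 * cos (2 * x)\<bar> \<le> 2 * \<bar>h\<bar>"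
    using cos_multiple_diff_le[of 2 x h] cos_multiple_diff_le[of 4 x h]
    unfolding cos_squared_mult_cos_double by (simp only: abs_le_iff) linarith
qed

lemma phase_mean'_bounds:
  "\<bar>phase_mean' \<gamma> x\<bar> \<le> 1 + 5 * \<bar>\<gamma>\<bar>" "\<bar>phase_mean' \<gamma> (x + h) - phase_mean' \<gamma> x\<bar> \<le> (1 + 8 * \<bar>\<gamma>\<bar>) * \<bar>h\<bar>"
proof -
  define p where "p = (\<lambda>x::real. (cos x)\<^sup>2 * cos (2 * x))"
  have p: "\<bar>p x\<bar> \<le> 1" "\<bar>p (x + h) - p x\<bar> \<le> 2 * \<bar>h\<bar>"
    unfolding p_def by (rule cos_squared_mult_cos_double_bounds)+
  have "\<bar>4 * \<gamma> * p x\<bar> \<le> 4 * \<bar>\<gamma>\<bar> * 1" unfolding abs_mult by (intro mult_mono p) auto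
  then show "\<bar>phase_mean' \<gamma> x\<bar> \<le> 1 + 5 * \<bar>\<gamma>\<bar>"
    unfolding phase_mean'_def p_def using abs_cos_le_one[of "2 * x"] by argo
  define U V Z where "U = 4 * \<gamma> * (p (x + h) - p x)" and "V = cos (2 * (x + h)) - cos (2 * x)"
    and "Z = 4 * \<bar>\<gamma>\<bar> * (2 * \<bar>h\<bar>)"
  have "\<bar>U\<bar> \<le> Z" unfolding U_def Z_def abs_mult by (intro mult_mono p) auto
  moreover have "\<bar>V\<bar> \<le> 2 * \<bar>h\<bar>" using cos_multiple_diff_le[of 2 x h] by (simp add: V_def)
  ultimately have "\<bar>- U - V / 2\<bar> \<le> Z + \<bar>h\<bar>" by linarith
  moreover have "phase_mean' \<gamma> (x + h) - phase_mean' \<gamma> x = - U - V / 2"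
    unfolding phase_mean'_def p_def U_def V_def by (simp add: right_diff_distrib diff_divide_distrib)
  ultimately have "\<bar>phase_mean' \<gamma> (x + h) - phase_mean' \<gamma> x\<bar> \<le> Z + \<bar>h\<bar>" by simp
  then show "\<bar>phase_mean' \<gamma> (x + h) - phase_mean' \<gamma> x\<bar> \<le> (1 + 8 * \<bar>\<gamma>\<bar>) * \<bar>h\<bar>"
    by (simp add: Z_def algebra_simps)
qed

lemma phase_lin_bounds:
  "\<bar>phase_lin \<gamma> x\<bar> \<le> 20 * (1 + \<bar>\<gamma>\<bar>)" "\<bar>phase_lin \<gamma> (x + h) - phase_lin \<gamma> x\<bar> \<le> 20 * (1 + \<bar>\<gamma>\<bar>) * \<bar>h\<bar>"
proof -
  define c where "c = (\<lambda>x::real. (cos x)\<^sup>2)"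
  have c: "\<bar>c y\<bar> \<le> 1" for y by (auto simp: c_def abs_square_le_1)
  have dc: "\<bar>c (x + h) - c x\<bar> \<le> \<bar>h\<bar>"
    using cos_multiple_diff_le[of 2 x h] unfolding c_def cos_squared_eq_double by argo
  let ?q = "phase_mean' \<gamma>"
  have "\<bar>?q x * c x\<bar> \<le> (1 + 5 * \<bar>\<gamma>\<bar>) * 1" unfolding abs_mult by (intro mult_mono c phase_mean'_bounds) auto
  then show "\<bar>phase_lin \<gamma> x\<bar> \<le> 20 * (1 + \<bar>\<gamma>\<bar>)"
    unfolding phase_lin_def c_def using abs_cos_le_one[of "2 * x"] abs_ge_zero[of \<gamma>] by argo
  have "\<bar>(?q (x + h) - ?q x) * c (x + h)\<bar> \<le> ((1 + 8 * \<bar>\<gamma>\<bar>) * \<bar>h\<bar>) * 1"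
    "\<bar>?q x * (c (x + h) - c x)\<bar> \<le> (1 + 5 * \<bar>\<gamma>\<bar>) * \<bar>h\<bar>"
    unfolding abs_mult by (intro mult_mono c dc phase_mean'_bounds; auto)+
  moreover have "phase_lin \<gamma> (x + h) - phase_lin \<gamma> x =
    - (cos (2 * (x + h)) - cos (2 * x)) - (?q (x + h) - ?q x) * c (x + h) - ?q x * (c (x + h) - c x)"
    unfolding phase_lin_def c_def by (simp add: algebra_simps)
  ultimately have "\<bar>phase_lin \<gamma> (x + h) - phase_lin \<gamma> x\<bar> \<le>
      2 * \<bar>h\<bar> + ((1 + 8 * \<bar>\<gamma>\<bar>) * \<bar>h\<bar>) + (1 + 5 * \<bar>\<gamma>\<bar>) * \<bar>h\<bar>"
    using cos_multiple_diff_le[of 2 x h] by linarith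
  also have "\<dots> = (4 + 13 * \<bar>\<gamma>\<bar>) * \<bar>h\<bar>" by (simp add: algebra_simps)
  also have "\<dots> \<le> 20 * (1 + \<bar>\<gamma>\<bar>) * \<bar>h\<bar>" by (intro mult_right_mono) auto
  finally show "\<bar>phase_lin \<gamma> (x + h) - phase_lin \<gamma> x\<bar> \<le> 20 * (1 + \<bar>\<gamma>\<bar>) * \<bar>h\<bar>" .
qed

text \<open>At order \<delta>, \<open>G\<close> compensates the linear term and
  \<open>phase_mean\<close> averages over the phase. At order \<open>\<delta>\<^sup>2\<close> there
  is one Poisson solution for each remaining fluctuation, multiplied by the phase function with
  which that fluctuation occurs in the increment.\<close>

definition corrector :: "real \<Rightarrow> real \<Rightarrow> real \<Rightarrow> real \<Rightarrow> real \<Rightarrow> real \<Rightarrow> real" where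
  "corrector \<delta> \<gamma> G K J \<phi> = \<delta> * (G * (- sin (2 * \<phi>) / 2) + phase_mean \<gamma> \<phi>)
    + \<delta>\<^sup>2 * (G * phase_lin \<gamma> \<phi> - K * cos (2 * \<phi>) + J * ((cos \<phi>)\<^sup>2 * cos (2 * \<phi>)))"

lemma corrector_bound:
  assumes "\<bar>G\<bar> \<le> M" "\<bar>K\<bar> \<le> M" "\<bar>J\<bar> \<le> M" and "0 < \<delta>" "\<delta> \<le> 1"
  shows "\<bar>corrector \<delta> \<gamma> G K J \<phi>\<bar> \<le> 40 * (1 + M) * (1 + \<bar>\<gamma>\<bar>) * \<delta>"
proof -
  have M: "0 \<le> M" using assms by linarith
  have s: "\<bar>sin y\<bar> \<le> 1" "\<bar>cos y\<bar> \<le> 1" for y :: real by auto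
  have 1: "\<bar>G * (- sin (2 * \<phi>) / 2)\<bar> \<le> M * 1"
    unfolding abs_mult using M assms s(1)[of "2 * \<phi>"] by (intro mult_mono; linarith)
  have "\<bar>(1 / 4 + \<gamma>) * sin (2 * \<phi>)\<bar> \<le> (1 + \<bar>\<gamma>\<bar>) * 1" "\<bar>\<gamma> / 4 * sin (4 * \<phi>)\<bar> \<le> (1 + \<bar>\<gamma>\<bar>) * 1"
    unfolding abs_mult by (intro mult_mono s; auto)+
  then have 2: "\<bar>phase_mean \<gamma> \<phi>\<bar> \<le> 2 * (1 + \<bar>\<gamma>\<bar>)" unfolding phase_mean_def by linarith
  have 3: "\<bar>G * phase_lin \<gamma> \<phi>\<bar> \<le> M * (20 * (1 + \<bar>\<gamma>\<bar>))" "\<bar>K * cos (2 * \<phi>)\<bar> \<le> M * 1"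
    "\<bar>J * ((cos \<phi>)\<^sup>2 * cos (2 * \<phi>))\<bar> \<le> M * 1"
    unfolding abs_mult[of G] abs_mult[of K] abs_mult[of J] using M assms
    by (intro mult_mono s phase_lin_bounds cos_squared_mult_cos_double_bounds; auto)+
  let ?X = "G * (- sin (2 * \<phi>) / 2) + phase_mean \<gamma> \<phi>"
  let ?Y = "G * phase_lin \<gamma> \<phi> - K * cos (2 * \<phi>) + J * ((cos \<phi>)\<^sup>2 * cos (2 * \<phi>))"
  have X: "\<bar>?X\<bar> \<le> M + 2 * (1 + \<bar>\<gamma>\<bar>)" using 1 2 by linarith
  have Y: "\<bar>?Y\<bar> \<le> M * (20 * (1 + \<bar>\<gamma>\<bar>)) + 2 * M" using 3 by linarith
  have "\<bar>corrector \<delta> \<gamma> G K J \<phi>\<bar> \<le> \<delta> * \<bar>?X\<bar> + \<delta>\<^sup>2 * \<bar>?Y\<bar>"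
    unfolding corrector_def using assms(4) abs_triangle_ineq[of "\<delta> * ?X" "\<delta>\<^sup>2 * ?Y"] by (simp add: abs_mult)
  also have "\<dots> \<le> \<delta> * (M + 2 * (1 + \<bar>\<gamma>\<bar>)) + \<delta> * (M * (20 * (1 + \<bar>\<gamma>\<bar>)) + 2 * M)"
    using X Y assms by (intro add_mono mult_mono) (auto simp: power2_eq_square mult_le_cancel_left1)
  also have "\<dots> = (23 * M + 2 + 2 * \<bar>\<gamma>\<bar> + 20 * (M * \<bar>\<gamma>\<bar>)) * \<delta>" by (simp add: algebra_simps)
  also have "\<dots> \<le> (40 * (1 + M) * (1 + \<bar>\<gamma>\<bar>)) * \<delta>"
  proof (rule mult_right_mono)
    have "40 * (1 + M) * (1 + \<bar>\<gamma>\<bar>) = 40 + 40 * M + 40 * \<bar>\<gamma>\<bar> + 40 * (M * \<bar>\<gamma>\<bar>)" by (simp add: algebra_simps)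
    moreover have "0 \<le> M * \<bar>\<gamma>\<bar>" using M by simp
    ultimately show "23 * M + 2 + 2 * \<bar>\<gamma>\<bar> + 20 * (M * \<bar>\<gamma>\<bar>) \<le> 40 * (1 + M) * (1 + \<bar>\<gamma>\<bar>)" using M by linarith
  qed (use assms in auto)
  finally show ?thesis .
qed

text \<open>With the Taylor remainders kept as letters \<open>e0\<close>, ..., \<open>e6\<close> and
  the trigonometric functions as letters too, the whole cancellation is a polynomial identity. The
  right-hand side gathers exactly the terms that contain a remainder.\<close>

lemma corrector_algebra:
  fixes h :: real
  assumes h: "h = e1 + \<delta> * (1 - r * c)" and L: "L = - C2 - P * c"
    and P: "P = \<gamma> - 4 * \<gamma> * (c * C2) - C2 / 2"
  shows "(e0 + (- \<delta> * r * (S / 2) + \<delta>\<^sup>2 * (C2 / 2 - r * C2 + r\<^sup>2 / 2 * (c * C2))))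
      + (\<delta> * (G' * (e2 - S / 2 - C2 * h) + (e3 + m + P * h))
          + \<delta>\<^sup>2 * (G' * (e4 + L) - K' * (e5 + C2) + J' * (e6 + c * C2)))
        - (\<delta> * (G * (- S / 2) + m) + \<delta>\<^sup>2 * (G * L - K * C2 + J * (c * C2)))
        - (\<delta> * (r + G' - G) * (- S / 2)
          + \<delta>\<^sup>2 * (\<gamma> + L * (r + G' - G) - C2 * (G' + K' - K)
            + c * C2 * (r\<^sup>2 / 2 + r * G' - 4 * \<gamma> + J' - J)))
      = e0 + (\<delta> * (G' * e2) - \<delta> * (G' * (C2 * e1))) + (\<delta> * e3 + \<delta> * (P * e1))
        + (\<delta>\<^sup>2 * (G' * e4) - \<delta>\<^sup>2 * (K' * e5) + \<delta>\<^sup>2 * (J' * e6))" (is "?l = ?r")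
proof -
  define u where "u = 1 - r * c"
  define s where "s = S / 2"
  define x where "x = C2 / 2 - r * C2 + r\<^sup>2 / 2 * (c * C2)"
  define y where "y = r\<^sup>2 / 2 + r * G' - 4 * \<gamma>"
  have S: "- S / 2 = - s" "S / 2 = s" by (auto simp: s_def)
  \<comment> \<open>The remainder-free second-order terms: \<open>C2 / 2\<close> cancels against the
    last summand of \<open>P\<close>, the terms \<open>- r * C2 - r * c * P\<close> form
    \<open>L * r\<close>, and everything multiplied by \<open>c * C2\<close> collects in
    \<open>y\<close>.\<close>
  have key: "x - G' * (C2 * u) + P * u = \<gamma> + L * r - C2 * G' + c * C2 * y"
    unfolding L u_def x_def y_def by (simp add: P field_simps power2_eq_square)
  have "?l - ?r = \<delta>\<^sup>2 * ((x - G' * (C2 * u) + P * u) - (\<gamma> + L * r - C2 * G' + c * C2 * y))"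
    unfolding h S x_def[symmetric] y_def[symmetric] u_def[symmetric] by (simp add: algebra_simps power2_eq_square)
  then show ?thesis unfolding key by simp
qed

text \<open>The leading term is grouped so that each bracket \<open>r + G' - G\<close>, \<open>G' + K' - K\<close>, \<open>\<dots> + J' - J\<close>
  averages to zero over the two preimages by the Poisson equations for \<open>G\<close>, \<open>K\<close> and \<open>J\<close>.\<close>

lemma corrected_increment_expansion:
  assumes M: "1 \<le> M" and T: "20 * (1 + \<bar>\<gamma>\<bar>) \<le> T"
    and b: "\<bar>r\<bar> \<le> M" "\<bar>G'\<bar> \<le> M" "\<bar>K'\<bar> \<le> M" "\<bar>J'\<bar> \<le> M"
    and \<delta>: "0 < \<delta>" "\<delta> \<le> 1"
    and \<rho>: "\<bar>\<rho> - (- \<delta> * r * (cos \<phi> * sin \<phi>) + \<delta>\<^sup>2 * (cos (2 * \<phi>) / 2 - r * cos (2 * \<phi>)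
         + r\<^sup>2 / 2 * ((cos \<phi>)\<^sup>2 * cos (2 * \<phi>))))\<bar> \<le> A * \<delta> ^ 3"
    and h: "\<bar>h - \<delta> * (1 - r * (cos \<phi>)\<^sup>2)\<bar> \<le> A * \<delta>\<^sup>2"
  shows "\<bar>\<rho> + corrector \<delta> \<gamma> G' K' J' (\<phi> + h) - corrector \<delta> \<gamma> G K J \<phi>
      - (\<delta> * (r + G' - G) * (- sin (2 * \<phi>) / 2)
        + \<delta>\<^sup>2 * (\<gamma> + phase_lin \<gamma> \<phi> * (r + G' - G) - cos (2 * \<phi>) * (G' + K' - K)
          + (cos \<phi>)\<^sup>2 * cos (2 * \<phi>) * (r\<^sup>2 / 2 + r * G' - 4 * \<gamma> + J' - J)))\<bar>
    \<le> (A + 2 * M * (T * (2 * M + A)\<^sup>2) + 2 * M * (T * A) + 3 * M * (T * (2 * M + A))) * \<delta> ^ 3"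
proof -
  define C2 P where "C2 = cos (2 * \<phi>)" and "P = phase_mean' \<gamma> \<phi>"
  define p where "p = (\<lambda>x::real. (cos x)\<^sup>2 * cos (2 * x))"
  define c where "c = (cos \<phi>)\<^sup>2"
  have A: "0 \<le> A" using h \<delta> by (smt (verit) mult_nonneg_nonpos zero_le_power2 zero_less_power mult_neg_pos)
  have T0: "20 \<le> T" using T abs_ge_zero[of \<gamma>] by argo
  define e0 where "e0 = \<rho> - (- \<delta> * r * (cos \<phi> * sin \<phi>) + \<delta>\<^sup>2 * (C2 / 2 - r * C2 + r\<^sup>2 / 2 * p \<phi>))"
  define e1 where "e1 = h - \<delta> * (1 - r * c)"
  define e2 where "e2 = - sin (2 * (\<phi> + h)) / 2 - (- sin (2 * \<phi>) / 2) - (- C2) * h"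
  define e3 where "e3 = phase_mean \<gamma> (\<phi> + h) - phase_mean \<gamma> \<phi> - P * h"
  define e4 where "e4 = phase_lin \<gamma> (\<phi> + h) - phase_lin \<gamma> \<phi>"
  define e5 where "e5 = cos (2 * (\<phi> + h)) - C2"
  define e6 where "e6 = p (\<phi> + h) - p \<phi>"
  \<comment> \<open>A bound for the phase step: \<open>2 * M * \<delta>\<close> for its main part,
    and \<open>A * \<delta>\<close> for the error since \<delta> is at most 1.\<close>
  define H where "H = (2 * M + A) * \<delta>"
  have "\<bar>r * c\<bar> \<le> M * 1" unfolding abs_mult using M b
    by (intro mult_mono) (auto simp: c_def abs_square_le_1)
  then have "\<bar>1 - r * c\<bar> \<le> 2 * M" using M by linarith
  then have "\<bar>\<delta> * (1 - r * c)\<bar> \<le> \<delta> * (2 * M)" unfolding abs_mult using M \<delta> by (intro mult_mono) auto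
  moreover have "A * \<delta>\<^sup>2 \<le> A * \<delta>" using A \<delta> by (intro mult_left_mono) (auto simp: power2_eq_square mult_le_cancel_left1)
  ultimately have hH: "\<bar>h\<bar> \<le> H" using h unfolding H_def c_def[symmetric] by (simp add: algebra_simps)
  have H0: "0 \<le> H" using hH by linarith
  have h2: "h\<^sup>2 \<le> H\<^sup>2" using power_mono[OF hH, of 2] by simp
  have e0: "\<bar>e0\<bar> \<le> A * \<delta> ^ 3" using \<rho> by (simp add: e0_def C2_def p_def)
  have e1: "\<bar>e1\<bar> \<le> A * \<delta>\<^sup>2" using h by (simp add: e1_def c_def)
  define X where "X = sin (2 * (\<phi> + h)) - sin (2 * \<phi>) - 2 * C2 * h"
  have "\<bar>X\<bar> \<le> 4 * h\<^sup>2" using sin_multiple_approx[of 2 \<phi> h] by (simp add: X_def C2_def)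
  moreover have "e2 = - X / 2" by (simp add: e2_def X_def diff_divide_distrib add_divide_distrib)
  ultimately have "\<bar>e2\<bar> \<le> 20 * h\<^sup>2" using zero_le_power2[of h] by linarith
  also have "\<dots> \<le> T * H\<^sup>2" using T0 h2 by (intro mult_mono) auto
  finally have e2: "\<bar>e2\<bar> \<le> T * H\<^sup>2" .
  have e3: "\<bar>e3\<bar> \<le> T * H\<^sup>2"
    unfolding e3_def P_def using T T0 h2 by (intro order.trans[OF phase_mean_approx] mult_mono) auto
  have e4: "\<bar>e4\<bar> \<le> T * H"
    unfolding e4_def using T T0 hH by (intro order.trans[OF phase_lin_bounds(2)] mult_mono) auto
  have e5: "\<bar>e5\<bar> \<le> T * H" unfolding e5_def C2_def
    using T0 hH by (intro order.trans[OF cos_multiple_diff_le] mult_mono) auto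
  have e6: "\<bar>e6\<bar> \<le> T * H" unfolding e6_def p_def
    using T0 hH by (intro order.trans[OF cos_squared_mult_cos_double_bounds(2)] mult_mono) auto
  have P: "\<bar>P\<bar> \<le> T" using phase_mean'_bounds(1)[of \<gamma> \<phi>] T by (simp add: P_def)
  have C2: "\<bar>C2\<bar> \<le> T" unfolding C2_def using T0 abs_cos_le_one[of "2 * \<phi>"] by linarith
  have p: "p \<phi> = c * C2" by (simp add: p_def c_def C2_def)
  have P_eq: "P = \<gamma> - 4 * \<gamma> * (c * C2) - C2 / 2" by (simp add: P_def phase_mean'_def c_def C2_def)
  have L_eq: "phase_lin \<gamma> \<phi> = - C2 - P * c" by (simp add: phase_lin_def P_def c_def C2_def)
  have s2: "cos \<phi> * sin \<phi> = sin (2 * \<phi>) / 2" by (simp add: sin_double)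
  have \<rho>_eq: "\<rho> = e0 + (- \<delta> * r * (sin (2 * \<phi>) / 2) + \<delta>\<^sup>2 * (C2 / 2 - r * C2 + r\<^sup>2 / 2 * (c * C2)))"
    unfolding e0_def p s2 by simp
  have h_eq: "h = e1 + \<delta> * (1 - r * c)" by (simp add: e1_def)
  have f_eq: "- sin (2 * (\<phi> + h)) / 2 = e2 - sin (2 * \<phi>) / 2 - C2 * h" by (simp add: e2_def)
  have m_eq: "phase_mean \<gamma> (\<phi> + h) = e3 + phase_mean \<gamma> \<phi> + P * h" by (simp add: e3_def)
  have l_eq: "phase_lin \<gamma> (\<phi> + h) = e4 + phase_lin \<gamma> \<phi>" by (simp add: e4_def)
  have c_eq: "cos (2 * (\<phi> + h)) = e5 + C2" by (simp add: e5_def)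
  have p_eq: "p (\<phi> + h) = e6 + p \<phi>" by (simp add: e6_def)
  let ?D = "\<rho> + corrector \<delta> \<gamma> G' K' J' (\<phi> + h) - corrector \<delta> \<gamma> G K J \<phi>
      - (\<delta> * (r + G' - G) * (- sin (2 * \<phi>) / 2)
        + \<delta>\<^sup>2 * (\<gamma> + phase_lin \<gamma> \<phi> * (r + G' - G) - C2 * (G' + K' - K)
          + p \<phi> * (r\<^sup>2 / 2 + r * G' - 4 * \<gamma> + J' - J)))"
  have "?D = e0 + (\<delta> * (G' * e2) - \<delta> * (G' * (C2 * e1))) + (\<delta> * e3 + \<delta> * (P * e1))
      + (\<delta>\<^sup>2 * (G' * e4) - \<delta>\<^sup>2 * (K' * e5) + \<delta>\<^sup>2 * (J' * e6))"
  proof -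
    have "corrector \<delta> \<gamma> G' K' J' (\<phi> + h) =
        \<delta> * (G' * (- sin (2 * (\<phi> + h)) / 2) + phase_mean \<gamma> (\<phi> + h))
      + \<delta>\<^sup>2 * (G' * phase_lin \<gamma> (\<phi> + h) - K' * cos (2 * (\<phi> + h)) + J' * p (\<phi> + h))"
      unfolding corrector_def p_def ..
    also have "\<dots> = \<delta> * (G' * (e2 - sin (2 * \<phi>) / 2 - C2 * h) + (e3 + phase_mean \<gamma> \<phi> + P * h))
      + \<delta>\<^sup>2 * (G' * (e4 + phase_lin \<gamma> \<phi>) - K' * (e5 + C2) + J' * (e6 + p \<phi>))"
      unfolding f_eq m_eq l_eq c_eq p_eq ..
    finally have "corrector \<delta> \<gamma> G' K' J' (\<phi> + h) = \<dots>" .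
    moreover have "corrector \<delta> \<gamma> G K J \<phi> = \<delta> * (G * (- sin (2 * \<phi>) / 2) + phase_mean \<gamma> \<phi>)
      + \<delta>\<^sup>2 * (G * phase_lin \<gamma> \<phi> - K * C2 + J * p \<phi>)"
      unfolding corrector_def p_def C2_def ..
    moreover note corrector_algebra[OF h_eq L_eq P_eq, of e0 "sin (2 * \<phi>)" G' e2 e3
        "phase_mean \<gamma> \<phi>" e4 K' e5 J' e6 G K J]
    ultimately show ?thesis by (simp only: \<rho>_eq p)
  qed
  moreover have "\<bar>\<delta> * (G' * e2)\<bar> \<le> \<delta> * (M * (T * H\<^sup>2))" "\<bar>\<delta> * (G' * (C2 * e1))\<bar> \<le> \<delta> * (M * (T * (A * \<delta>\<^sup>2)))"
    "\<bar>\<delta> * e3\<bar> \<le> \<delta> * (M * (T * H\<^sup>2))" "\<bar>\<delta> * (P * e1)\<bar> \<le> \<delta> * (M * (T * (A * \<delta>\<^sup>2)))"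
    "\<bar>\<delta>\<^sup>2 * (G' * e4)\<bar> \<le> \<delta>\<^sup>2 * (M * (T * H))" "\<bar>\<delta>\<^sup>2 * (K' * e5)\<bar> \<le> \<delta>\<^sup>2 * (M * (T * H))"
    "\<bar>\<delta>\<^sup>2 * (J' * e6)\<bar> \<le> \<delta>\<^sup>2 * (M * (T * H))"
  proof -
    have "\<bar>G' * e2\<bar> \<le> M * (T * H\<^sup>2)" unfolding abs_mult using M b e2 by (intro mult_mono) auto
    then show "\<bar>\<delta> * (G' * e2)\<bar> \<le> \<delta> * (M * (T * H\<^sup>2))" using \<delta> by (simp add: abs_mult)
    have Ce: "\<bar>C2 * e1\<bar> \<le> T * (A * \<delta>\<^sup>2)" "\<bar>P * e1\<bar> \<le> T * (A * \<delta>\<^sup>2)"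
      unfolding abs_mult using T0 C2 P e1 by (intro mult_mono; auto)+
    have TA: "0 \<le> T * (A * \<delta>\<^sup>2)" using T0 A by simp
    have "\<bar>G' * (C2 * e1)\<bar> \<le> M * (T * (A * \<delta>\<^sup>2))" unfolding abs_mult[of G'] using M b Ce by (intro mult_mono) auto
    then show "\<bar>\<delta> * (G' * (C2 * e1))\<bar> \<le> \<delta> * (M * (T * (A * \<delta>\<^sup>2)))" using \<delta> by (simp add: abs_mult)
    have "1 * \<bar>e3\<bar> \<le> M * (T * H\<^sup>2)" using M e3 by (intro mult_mono) auto
    then show "\<bar>\<delta> * e3\<bar> \<le> \<delta> * (M * (T * H\<^sup>2))" using \<delta> by (simp add: abs_mult)
    have "1 * \<bar>P * e1\<bar> \<le> M * (T * (A * \<delta>\<^sup>2))" using M Ce by (intro mult_mono) auto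
    then show "\<bar>\<delta> * (P * e1)\<bar> \<le> \<delta> * (M * (T * (A * \<delta>\<^sup>2)))" using \<delta> by (simp add: abs_mult)
    have "\<bar>G' * e4\<bar> \<le> M * (T * H)" "\<bar>K' * e5\<bar> \<le> M * (T * H)" "\<bar>J' * e6\<bar> \<le> M * (T * H)"
      unfolding abs_mult using M b e4 e5 e6 by (intro mult_mono; auto)+
    then show "\<bar>\<delta>\<^sup>2 * (G' * e4)\<bar> \<le> \<delta>\<^sup>2 * (M * (T * H))" "\<bar>\<delta>\<^sup>2 * (K' * e5)\<bar> \<le> \<delta>\<^sup>2 * (M * (T * H))"
      "\<bar>\<delta>\<^sup>2 * (J' * e6)\<bar> \<le> \<delta>\<^sup>2 * (M * (T * H))" by (auto simp: abs_mult intro!: mult_left_mono)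
  qed
  moreover have "\<bar>a + (b1 - b2) + (b3 + b4) + (b5 - b6 + b7)\<bar> \<le> A' + 2 * B + 2 * C + 3 * D"
    if "\<bar>a\<bar> \<le> A'" "\<bar>b1\<bar> \<le> B" "\<bar>b2\<bar> \<le> C" "\<bar>b3\<bar> \<le> B" "\<bar>b4\<bar> \<le> C"
      "\<bar>b5\<bar> \<le> D" "\<bar>b6\<bar> \<le> D" "\<bar>b7\<bar> \<le> D" for a b1 b2 b3 b4 b5 b6 b7 A' B C D :: real
    using that[THEN abs_le_D1] that[THEN abs_le_D2] by (intro abs_leI) linarith+
  ultimately have "\<bar>?D\<bar> \<le> A * \<delta> ^ 3 + 2 * (\<delta> * (M * (T * H\<^sup>2))) + 2 * (\<delta> * (M * (T * (A * \<delta>\<^sup>2))))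
      + 3 * (\<delta>\<^sup>2 * (M * (T * H)))"
    using e0 by (simp only:)
  also have "\<dots> = (A + 2 * M * (T * (2 * M + A)\<^sup>2) + 2 * M * (T * A) + 3 * M * (T * (2 * M + A))) * \<delta> ^ 3"
    unfolding H_def by (simp add: algebra_simps power2_eq_square power3_eq_cube)
  finally show ?thesis by (simp add: C2_def p_def)
qed

section \<open>Drift and exponential moments\<close>

text \<open>In every equation \<open>y\<close> is the current point and the average runs over its
  two possible successors. Since the transfer operator preserves integrals, the equation for
  \<open>J\<close> pins down \<gamma>: it forces \<open>4 * \<gamma>\<close> to be the mean of
  \<open>r\<^sup>2 / 2 + r * G\<close>.\<close>

locale phase_drift =
  fixes r G K J :: "real \<Rightarrow> real" and \<gamma> M :: real
  assumes M: "1 \<le> M"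
    and bounds: "\<bar>r y\<bar> \<le> M" "\<bar>G y\<bar> \<le> M" "\<bar>K y\<bar> \<le> M" "\<bar>J y\<bar> \<le> M"
    and poisson_G: "doubling_op (\<lambda>x. r x + G x) y = G y"
    and poisson_K: "doubling_op (\<lambda>x. G x + K x) y = K y"
    and poisson_J: "doubling_op (\<lambda>x. ((r x)\<^sup>2 / 2 + r x * G x - 4 * \<gamma>) + J x) y = J y"
    and continuous: "continuous_on UNIV r" "continuous_on UNIV G" "continuous_on UNIV K" "continuous_on UNIV J"
    and periodic: "r (y + 1) = r y"
begin

text \<open>Adding the principal logarithm of a factor close to 1 lifts the phase to the real line
  step by step, so no branch has to be chosen for the product and the state stays continuous in the
  starting point.\<close>

definition log_step :: "real \<Rightarrow> real \<Rightarrow> complex \<Rightarrow> complex" where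
  "log_step \<delta> y l = l + Ln (1 + log_increment \<delta> (r y) (Im l))"

definition potential :: "real \<Rightarrow> real \<Rightarrow> complex \<Rightarrow> real" where
  "potential \<delta> y l = Re l + corrector \<delta> \<gamma> (G y) (K y) (J y) (Im l)"

definition martingale_part :: "real \<Rightarrow> real \<Rightarrow> real \<Rightarrow> real \<Rightarrow> real" where
  "martingale_part \<delta> y x \<phi> = \<delta> * (r x + G x - G y) * (- sin (2 * \<phi>) / 2)
     + \<delta>\<^sup>2 * (phase_lin \<gamma> \<phi> * (r x + G x - G y) - cos (2 * \<phi>) * (G x + K x - K y)
        + (cos \<phi>)\<^sup>2 * cos (2 * \<phi>) * ((r x)\<^sup>2 / 2 + r x * G x - 4 * \<gamma> + J x - J y))"

text \<open>Each Poisson equation says that its bracket takes opposite values at the two preimages,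
  and the phase factors are the same for both.\<close>

lemma martingale_part_centered:
  "martingale_part \<delta> y (y / 2) \<phi> + martingale_part \<delta> y ((y + 1) / 2) \<phi> = 0"
proof -
  define a where "a = (\<lambda>x. r x + G x - G y)"
  define b where "b = (\<lambda>x. G x + K x - K y)"
  define c where "c = (\<lambda>x. (r x)\<^sup>2 / 2 + r x * G x - 4 * \<gamma> + J x - J y)"
  have abc: "a ((y + 1) / 2) = - a (y / 2)" "b ((y + 1) / 2) = - b (y / 2)" "c ((y + 1) / 2) = - c (y / 2)"
    using poisson_G[of y] poisson_K[of y] poisson_J[of y] by (auto simp: doubling_op_def a_def b_def c_def)
  have m: "martingale_part \<delta> y x \<phi> = \<delta> * a x * (- sin (2 * \<phi>) / 2)
      + \<delta>\<^sup>2 * (phase_lin \<gamma> \<phi> * a x - cos (2 * \<phi>) * b x + (cos \<phi>)\<^sup>2 * cos (2 * \<phi>) * c x)" for x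
    by (simp add: martingale_part_def a_def b_def c_def)
  show ?thesis unfolding m abc by (simp add: algebra_simps)
qed

lemma martingale_part_bound:
  assumes "0 < \<delta>" "\<delta> \<le> 1"
  shows "\<bar>martingale_part \<delta> y x \<phi>\<bar> \<le> (200 * (1 + \<bar>\<gamma>\<bar>) * M\<^sup>2) * \<delta>"
proof -
  have MM: "M \<le> M\<^sup>2" "1 \<le> M\<^sup>2" using M by (auto simp: power2_eq_square mult_le_cancel_left1 intro: order.trans[of 1 M])
  define a where "a = r x + G x - G y"
  define b where "b = G x + K x - K y"
  define c where "c = (r x)\<^sup>2 / 2 + r x * G x - 4 * \<gamma> + J x - J y"
  have a: "\<bar>a\<bar> \<le> 3 * M" and b: "\<bar>b\<bar> \<le> 3 * M"
    using bounds(1)[of x] bounds(2)[of x] bounds(2)[of y] bounds(3)[of x] bounds(3)[of y] unfolding a_def b_def by linarith+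
  have "\<bar>r x * G x\<bar> \<le> M * M" "\<bar>r x * r x\<bar> \<le> M * M"
    unfolding abs_mult using M bounds by (intro mult_mono; auto)+
  then have c: "\<bar>c\<bar> \<le> 4 * M\<^sup>2 + 4 * \<bar>\<gamma>\<bar>"
    using bounds(4)[of x] bounds(4)[of y] MM unfolding c_def power2_eq_square by linarith
  have "\<bar>a * (- sin (2 * \<phi>) / 2)\<bar> \<le> (3 * M) * 1"
    unfolding abs_mult using a M abs_sin_le_one[of "2 * \<phi>"] by (intro mult_mono; linarith)
  then have A: "\<bar>a * (- sin (2 * \<phi>) / 2)\<bar> \<le> 3 * M\<^sup>2" using MM by linarith
  have "\<bar>phase_lin \<gamma> \<phi> * a\<bar> \<le> (20 * (1 + \<bar>\<gamma>\<bar>)) * (3 * M)"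
    unfolding abs_mult by (intro mult_mono a phase_lin_bounds) auto
  also have "\<dots> = 60 * ((1 + \<bar>\<gamma>\<bar>) * M)" by simp
  also have "\<dots> \<le> 60 * ((1 + \<bar>\<gamma>\<bar>) * M\<^sup>2)" using MM by (intro mult_left_mono) auto
  finally have B1: "\<bar>phase_lin \<gamma> \<phi> * a\<bar> \<le> 60 * ((1 + \<bar>\<gamma>\<bar>) * M\<^sup>2)" .
  have "\<bar>cos (2 * \<phi>) * b\<bar> \<le> 1 * (3 * M)" unfolding abs_mult by (intro mult_mono b) auto
  then have B2: "\<bar>cos (2 * \<phi>) * b\<bar> \<le> 3 * M\<^sup>2" using MM by linarith
  have "\<bar>((cos \<phi>)\<^sup>2 * cos (2 * \<phi>)) * c\<bar> \<le> 1 * (4 * M\<^sup>2 + 4 * \<bar>\<gamma>\<bar>)"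
    unfolding abs_mult[of _ c] by (intro mult_mono c cos_squared_mult_cos_double_bounds) auto
  moreover have "\<bar>\<gamma>\<bar> \<le> (1 + \<bar>\<gamma>\<bar>) * M\<^sup>2" using MM mult_mono[of "\<bar>\<gamma>\<bar>" "1 + \<bar>\<gamma>\<bar>" 1 "M\<^sup>2"] by simp
  moreover have g: "M\<^sup>2 \<le> (1 + \<bar>\<gamma>\<bar>) * M\<^sup>2" by (simp add: algebra_simps)
  then have "1 * (4 * M\<^sup>2 + 4 * \<bar>\<gamma>\<bar>) \<le> 8 * ((1 + \<bar>\<gamma>\<bar>) * M\<^sup>2)"
    using \<open>\<bar>\<gamma>\<bar> \<le> (1 + \<bar>\<gamma>\<bar>) * M\<^sup>2\<close> by argo
  ultimately have B3: "\<bar>((cos \<phi>)\<^sup>2 * cos (2 * \<phi>)) * c\<bar> \<le> 8 * ((1 + \<bar>\<gamma>\<bar>) * M\<^sup>2)"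
    using order.trans by blast
  let ?B = "phase_lin \<gamma> \<phi> * a - cos (2 * \<phi>) * b + ((cos \<phi>)\<^sup>2 * cos (2 * \<phi>)) * c"
  have B: "\<bar>?B\<bar> \<le> 80 * ((1 + \<bar>\<gamma>\<bar>) * M\<^sup>2)"
    using B1 B2 B3 g zero_le_power2[of M] by linarith
  have "martingale_part \<delta> y x \<phi> = \<delta> * (a * (- sin (2 * \<phi>) / 2)) + \<delta>\<^sup>2 * ?B"
    by (simp add: martingale_part_def a_def b_def c_def)
  then have "\<bar>martingale_part \<delta> y x \<phi>\<bar> \<le> \<delta> * \<bar>a * (- sin (2 * \<phi>) / 2)\<bar> + \<delta>\<^sup>2 * \<bar>?B\<bar>"
    using assms abs_triangle_ineq[of "\<delta> * (a * (- sin (2 * \<phi>) / 2))" "\<delta>\<^sup>2 * ?B"] by (simp add: abs_mult)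
  also have "\<dots> \<le> \<delta> * (3 * M\<^sup>2) + \<delta> * (80 * ((1 + \<bar>\<gamma>\<bar>) * M\<^sup>2))"
    using assms A B by (intro add_mono mult_mono) (auto simp: power2_eq_square mult_le_cancel_left1)
  also have "\<dots> = (3 * M\<^sup>2 + 80 * ((1 + \<bar>\<gamma>\<bar>) * M\<^sup>2)) * \<delta>" by (simp add: algebra_simps)
  also have "\<dots> \<le> (200 * (1 + \<bar>\<gamma>\<bar>) * M\<^sup>2) * \<delta>"
  proof (rule mult_right_mono)
    have "3 * M\<^sup>2 + 80 * q \<le> 200 * q" if "M\<^sup>2 \<le> q" for q using that zero_le_power2[of M] by linarith
    from this[OF g] show "3 * M\<^sup>2 + 80 * ((1 + \<bar>\<gamma>\<bar>) * M\<^sup>2) \<le> 200 * (1 + \<bar>\<gamma>\<bar>) * M\<^sup>2"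
      by (simp only: mult.assoc)
  qed (use assms in auto)
  finally show ?thesis .
qed

text \<open>The interface to the probabilistic part, with constants depending only on
  \<open>M\<close> and \<gamma>. The bound of order \<delta> on the increment controls the quadratic
  term of exponential moments; the bound of order \<open>\<delta> ^ 3\<close> controls the
  conditional mean.\<close>

lemma drift:
  obtains C \<delta>\<^sub>0 where "1 \<le> C" "0 < \<delta>\<^sub>0" "\<delta>\<^sub>0 \<le> 1"
    "\<And>\<delta> y \<phi>. 0 < \<delta> \<Longrightarrow> \<delta> \<le> \<delta>\<^sub>0 \<Longrightarrow> cmod (log_increment \<delta> (r y) \<phi>) \<le> 1 / 2"
    "\<And>\<delta> y l. 0 < \<delta> \<Longrightarrow> \<delta> \<le> \<delta>\<^sub>0 \<Longrightarrow> \<bar>potential \<delta> y l - Re l\<bar> \<le> C * \<delta>"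
    "\<And>\<delta> y x l. 0 < \<delta> \<Longrightarrow> \<delta> \<le> \<delta>\<^sub>0 \<Longrightarrow> \<bar>potential \<delta> x (log_step \<delta> x l) - potential \<delta> y l\<bar> \<le> C * \<delta>"
    "\<And>\<delta> y x l. 0 < \<delta> \<Longrightarrow> \<delta> \<le> \<delta>\<^sub>0 \<Longrightarrow>
       \<bar>potential \<delta> x (log_step \<delta> x l) - potential \<delta> y l - (\<delta>\<^sup>2 * \<gamma> + martingale_part \<delta> y x (Im l))\<bar> \<le> C * \<delta> ^ 3"
proof -
  define A where "A = 2800 * M ^ 3"
  define T where "T = 20 * (1 + \<bar>\<gamma>\<bar>)"
  define C1 where "C1 = A + 2 * M * (T * (2 * M + A)\<^sup>2) + 2 * M * (T * A) + 3 * M * (T * (2 * M + A))"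
  define C2 where "C2 = 40 * (1 + M) * (1 + \<bar>\<gamma>\<bar>)"
  define C3 where "C3 = 200 * (1 + \<bar>\<gamma>\<bar>) * M\<^sup>2"
  define C where "C = 1 + C1 + C2 + C3 + \<bar>\<gamma>\<bar>"
  define \<delta>\<^sub>0 where "\<delta>\<^sub>0 = 1 / (14 * M)"
  have C0: "0 \<le> C1" "0 \<le> C2" "0 \<le> C3" using M by (auto simp: C1_def C2_def C3_def A_def T_def)
  have d0: "0 < \<delta>\<^sub>0" "\<delta>\<^sub>0 \<le> 1" using M by (auto simp: \<delta>\<^sub>0_def)
  have pot: "\<bar>potential \<delta> y l - Re l\<bar> \<le> C2 * \<delta>" if "0 < \<delta>" "\<delta> \<le> \<delta>\<^sub>0" for \<delta> y l
    unfolding potential_def C2_def using corrector_bound[OF bounds(2-4), of \<delta> \<gamma>] that d0 by auto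
  have main: "\<bar>potential \<delta> x (log_step \<delta> x l) - potential \<delta> y l - (\<delta>\<^sup>2 * \<gamma> + martingale_part \<delta> y x (Im l))\<bar> \<le> C1 * \<delta> ^ 3"
    if \<delta>: "0 < \<delta>" "\<delta> \<le> \<delta>\<^sub>0" for \<delta> y x l
  proof -
    have \<delta>1: "\<delta> \<le> 1" using \<delta> d0 by linarith
    note ex = log_increment_expansion[OF M bounds(1) \<delta>[unfolded \<delta>\<^sub>0_def], of x "Im l", folded A_def]
    define \<rho> h where "\<rho> = Re (Ln (1 + log_increment \<delta> (r x) (Im l)))"
      and "h = Im (Ln (1 + log_increment \<delta> (r x) (Im l)))"
    have "potential \<delta> x (log_step \<delta> x l) = Re l + \<rho> + corrector \<delta> \<gamma> (G x) (K x) (J x) (Im l + h)"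
      by (simp add: potential_def log_step_def \<rho>_def h_def)
    moreover have "\<delta>\<^sup>2 * \<gamma> + martingale_part \<delta> y x (Im l) =
        \<delta> * (r x + G x - G y) * (- sin (2 * Im l) / 2)
        + \<delta>\<^sup>2 * (\<gamma> + phase_lin \<gamma> (Im l) * (r x + G x - G y) - cos (2 * Im l) * (G x + K x - K y)
          + (cos (Im l))\<^sup>2 * cos (2 * Im l) * ((r x)\<^sup>2 / 2 + r x * G x - 4 * \<gamma> + J x - J y))"
      by (simp add: martingale_part_def algebra_simps)
    moreover note corrected_increment_expansion[OF M order.refl bounds(1-4) \<delta>(1) \<delta>1 ex(2,3), of \<gamma> x x x "G y" "K y" "J y",
        folded \<rho>_def h_def T_def, folded C1_def]
    ultimately show ?thesis by (simp only: potential_def[of \<delta> y l] add.assoc add_diff_cancel_left diff_add_eq)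
  qed
  show ?thesis
  proof (rule that[of C \<delta>\<^sub>0])
    fix \<delta> y x l assume \<delta>: "0 < \<delta>" "\<delta> \<le> \<delta>\<^sub>0"
    have \<delta>1: "\<delta> \<le> 1" using \<delta> d0 by linarith
    have "C1 * \<delta> ^ 3 \<le> C1 * \<delta>"
      using C0 \<delta> \<delta>1 power_decreasing[of 1 3 \<delta>] by (intro mult_left_mono) auto
    moreover have "\<bar>\<gamma>\<bar> * \<delta>\<^sup>2 \<le> \<bar>\<gamma>\<bar> * \<delta>"
      using \<delta> \<delta>1 power_decreasing[of 1 2 \<delta>] by (intro mult_left_mono) auto
    then have "\<bar>\<delta>\<^sup>2 * \<gamma>\<bar> \<le> \<bar>\<gamma>\<bar> * \<delta>" by (simp add: abs_mult mult.commute)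
    moreover have "\<bar>martingale_part \<delta> y x (Im l)\<bar> \<le> C3 * \<delta>"
      unfolding C3_def using \<delta> \<delta>1 by (intro martingale_part_bound) auto
    ultimately have "\<bar>potential \<delta> x (log_step \<delta> x l) - potential \<delta> y l\<bar> \<le> C1 * \<delta> + \<bar>\<gamma>\<bar> * \<delta> + C3 * \<delta>"
      using main[OF \<delta>, of x l y] by linarith
    also have "\<dots> = (C1 + \<bar>\<gamma>\<bar> + C3) * \<delta>" by (simp add: algebra_simps)
    also have "\<dots> \<le> C * \<delta>" using C0 \<delta> by (intro mult_right_mono) (auto simp: C_def)
    finally show "\<bar>potential \<delta> x (log_step \<delta> x l) - potential \<delta> y l\<bar> \<le> C * \<delta>" .
    have "C1 * \<delta> ^ 3 \<le> C * \<delta> ^ 3" "C2 * \<delta> \<le> C * \<delta>"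
      using C0 \<delta> by (auto intro!: mult_right_mono simp: C_def)
    then show "\<bar>potential \<delta> x (log_step \<delta> x l) - potential \<delta> y l - (\<delta>\<^sup>2 * \<gamma> + martingale_part \<delta> y x (Im l))\<bar> \<le> C * \<delta> ^ 3"
      and "\<bar>potential \<delta> y l - Re l\<bar> \<le> C * \<delta>"
      using main[OF \<delta>, of x l y] pot[OF \<delta>, of y l] by linarith+
  next
    fix \<delta> y \<phi> assume "0 < \<delta>" "\<delta> \<le> \<delta>\<^sub>0"
    then show "cmod (log_increment \<delta> (r y) \<phi>) \<le> 1 / 2"
      by (intro log_increment_expansion(1)[OF M bounds(1)]) (auto simp: \<delta>\<^sub>0_def)
  qed (use C0 d0 in \<open>auto simp: C_def\<close>)
qed

end

section \<open>Exponential moments and integration on the circle\<close>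

lemma exp_le_one_plus_quadratic:
  fixes x :: real
  assumes "\<bar>x\<bar> \<le> 1"
  shows "exp x \<le> 1 + x + x\<^sup>2"
proof (cases "0 \<le> x")
  case True
  then show ?thesis using exp_bound[of x] assms by auto
next
  case False
  define u where "u = - x"
  have u: "0 < u" using False by (simp add: u_def)
  \<comment> \<open>The product equals 1 + u^3.\<close>
  have "1 \<le> (1 - u + u\<^sup>2) * (1 + u)"
    using u by (simp add: algebra_simps power2_eq_square)
  also have "\<dots> \<le> (1 - u + u\<^sup>2) * exp u"
  proof (intro mult_left_mono exp_ge_add_one_self)
    have "0 \<le> (1 - u / 2)\<^sup>2 + 3 / 4 * u\<^sup>2" by (intro add_nonneg_nonneg) auto
    then show "0 \<le> 1 - u + u\<^sup>2" by (simp add: power2_eq_square field_simps)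
  qed
  finally have "exp (- u) \<le> 1 - u + u\<^sup>2" by (simp add: exp_minus field_simps)
  then show ?thesis by (simp add: u_def)
qed

text \<open>This is a conditional expectation over a fair choice between two values. The quadratic
  bound for the exponential keeps the linear terms intact, so first-order fluctuations cancel in the
  average and contribute only \<open>t\<^sup>2 * R\<^sup>2\<close>.\<close>

lemma exp_average_le:
  fixes t :: real
  assumes a: "\<bar>a\<bar> \<le> R" and b: "\<bar>b\<bar> \<le> R" and t: "\<bar>t\<bar> * R \<le> 1"
    and avg: "\<bar>(a + b) / 2 - \<mu>\<bar> \<le> e"
  shows "(exp (t * a) + exp (t * b)) / 2 \<le> exp (t * \<mu> + \<bar>t\<bar> * e + t\<^sup>2 * R\<^sup>2)"
proof -
  have small: "\<bar>t * a\<bar> \<le> 1" "\<bar>t * b\<bar> \<le> 1"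
    using mult_left_mono[OF a, of "\<bar>t\<bar>"] mult_left_mono[OF b, of "\<bar>t\<bar>"] t by (auto simp: abs_mult)
  have sq: "(t * a)\<^sup>2 \<le> t\<^sup>2 * R\<^sup>2" "(t * b)\<^sup>2 \<le> t\<^sup>2 * R\<^sup>2"
    using power_mono[OF a, of 2] power_mono[OF b, of 2] by (auto simp: power_mult_distrib mult_left_mono)
  have "t * ((a + b) / 2 - \<mu>) \<le> \<bar>t\<bar> * e"
    using mult_left_mono[OF avg, of "\<bar>t\<bar>"] abs_ge_self[of "t * ((a + b) / 2 - \<mu>)"]
    unfolding abs_mult by simp
  then have lin: "(t * a + t * b) / 2 \<le> t * \<mu> + \<bar>t\<bar> * e" by (simp add: algebra_simps add_divide_distrib)
  have "(exp (t * a) + exp (t * b)) / 2 \<le> 1 + (t * a + t * b) / 2 + t\<^sup>2 * R\<^sup>2"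
  proof -
    have "(x + y) / 2 \<le> 1 + (u + v) / 2 + w"
      if "x \<le> 1 + u + p" "y \<le> 1 + v + q" "p \<le> w" "q \<le> w" for x y u v w p q :: real
      using that by (simp add: field_simps)
    then show ?thesis
      using exp_le_one_plus_quadratic[OF small(1)] exp_le_one_plus_quadratic[OF small(2)] sq .
  qed
  also have "\<dots> \<le> 1 + (t * \<mu> + \<bar>t\<bar> * e + t\<^sup>2 * R\<^sup>2)" using lin by linarith
  also have "\<dots> \<le> exp (t * \<mu> + \<bar>t\<bar> * e + t\<^sup>2 * R\<^sup>2)" by (rule exp_ge_add_one_self)
  finally show ?thesis .
qed

text \<open>Links the measure on the half-open fundamental domain with the integral over the closed
  unit interval used for the transfer operator; the endpoint is negligible.\<close>

lemma integral_circle: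
  fixes f :: "real \<Rightarrow> real"
  assumes "continuous_on UNIV f"
  shows "integrable circle f" and "(LINT x|circle. f x) = integral {0..1} f"
proof -
  have "f absolutely_integrable_on {0..1}"
    using assms by (intro absolutely_integrable_continuous_real) (auto intro: continuous_on_subset)
  then have "f absolutely_integrable_on {0..<1}"
    by (rule set_integrable_subset) auto
  then show int: "integrable circle f"
    unfolding circle_def by (intro absolutely_integrable_imp_integrable) auto
  have "{0..1} - {0..<1} = {1::real}" by auto
  then have "integral {0..<1} f = integral {0..1} f"
    by (intro integral_subset_negligible) auto
  then show "(LINT x|circle. f x) = integral {0..1} f"
    using lebesgue_integral_eq_integral[of "{0..<1}" f] int by (simp add: circle_def)
qed

lemma circle_markov:
  assumes f: "continuous_on UNIV f" and nonneg: "\<And>x. 0 \<le> f x" and c: "(0::real) < c"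
  shows "measure circle {x \<in> space circle. c \<le> f x} \<le> integral {0..1} f / c"
  using integral_Markov_inequality_measure[OF integral_circle(1)[OF f], of "{}" c] nonneg c
    integral_circle(2)[OF f] by simp

section \<open>Moments along the backward orbit\<close>

context phase_drift
begin

text \<open>The step at \<open>2 ^ (N - 1) * x\<close> is made first and the step at
  \<open>x\<close> last. Both preimages of \<open>y\<close> thus share the state reached at
  \<open>y\<close>, and applying the transfer operator amounts to conditioning on
  \<open>y\<close>.\<close>

primrec log_orbit :: "real \<Rightarrow> complex \<Rightarrow> nat \<Rightarrow> real \<Rightarrow> complex" where
  "log_orbit \<delta> l 0 x = l"
| "log_orbit \<delta> l (Suc N) x = log_step \<delta> x (log_orbit \<delta> l N (2 * x))"

lemma log_orbit_periodic: "log_orbit \<delta> l N (x + 1) = log_orbit \<delta> l N x"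
proof (induction N arbitrary: x)
  case (Suc N)
  have "log_orbit \<delta> l N (2 * (x + 1)) = log_orbit \<delta> l N (2 * x + 1 + 1)" by (simp add: algebra_simps)
  also have "\<dots> = log_orbit \<delta> l N (2 * x)" by (simp only: Suc.IH)
  finally show ?case by (simp add: log_step_def periodic)
qed simp

lemma one_plus_nonpos: "cmod w \<le> 1 / 2 \<Longrightarrow> 1 + w \<notin> \<real>\<^sub>\<le>\<^sub>0"
  using abs_Re_le_cmod[of w] by (auto simp: complex_nonpos_Reals_iff)

lemma log_orbit_continuous:
  assumes small: "\<And>y \<phi>. cmod (log_increment \<delta> (r y) \<phi>) \<le> 1 / 2"
  shows "continuous_on UNIV (log_orbit \<delta> l N)"
proof (induction N)
  case 0
  then show ?case by simp
next
  case (Suc N)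
  have o: "continuous_on UNIV (\<lambda>x. log_orbit \<delta> l N (2 * x))"
    by (intro continuous_on_compose2[OF Suc.IH] continuous_intros) auto
  show ?case
    unfolding log_orbit.simps log_step_def
    by (intro continuous_intros o one_plus_nonpos small)
      (simp add: log_increment_def Complex_eq, intro continuous_intros o continuous)
qed

lemma potential_continuous:
  assumes "continuous_on UNIV l"
  shows "continuous_on UNIV (\<lambda>x. potential \<delta> x (l x))"
  unfolding potential_def corrector_def phase_mean_def phase_lin_def phase_mean'_def
  by (intro continuous_intros assms continuous) auto

text \<open>The transfer operator preserves the integral and acts as the conditional expectation of
  the last step, so each step costs at most a factor \<open>exp R\<close>.\<close>

lemma moment_bound:
  assumes small: "\<And>y \<phi>. cmod (log_increment \<delta> (r y) \<phi>) \<le> 1 / 2"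
    and step: "\<And>y l. (exp (t * (potential \<delta> (y / 2) (log_step \<delta> (y / 2) l) - potential \<delta> y l))
      + exp (t * (potential \<delta> ((y + 1) / 2) (log_step \<delta> ((y + 1) / 2) l) - potential \<delta> y l))) / 2 \<le> exp R"
    and init: "\<And>x. t * potential \<delta> x l \<le> B"
  shows "integral {0..1} (\<lambda>x. exp (t * potential \<delta> x (log_orbit \<delta> l N x))) \<le> exp (R * N + B)"
proof (induction N)
  case 0
  have "integral {0..1} (\<lambda>x. exp (t * potential \<delta> x l)) \<le> integral {0..1::real} (\<lambda>x. exp B)"
    using init
    by (intro Henstock_Kurzweil_Integration.integral_le integrable_continuous_real
        continuous_intros continuous_on_subset[OF potential_continuous]) auto
  then show ?case by simp
next
  case (Suc N)
  define F where "F = (\<lambda>N x. exp (t * potential \<delta> x (log_orbit \<delta> l N x)))"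
  have cont: "continuous_on S (F N)" for S N
    unfolding F_def by (intro continuous_intros continuous_on_subset[OF potential_continuous]
        log_orbit_continuous small) auto
  have le: "doubling_op (F (Suc N)) y \<le> exp R * F N y" for y
  proof -
    define L where "L = log_orbit \<delta> l N y"
    define V where "V = potential \<delta> y L"
    have "F (Suc N) z = exp (t * (potential \<delta> z (log_step \<delta> z L) - V)) * exp (t * V)"
      if "log_orbit \<delta> l N (2 * z) = L" for z
      using that by (simp add: F_def algebra_simps flip: exp_add)
    \<comment> \<open>On the real line the second preimage doubles to \<open>y + 1\<close>;
      periodicity of \<open>log_orbit\<close> brings it back to the state at
      \<open>y\<close>.\<close>
    moreover have "2 * (y / 2) = y" "2 * ((y + 1) / 2) = y + 1" by simp_all
    then have "log_orbit \<delta> l N (2 * (y / 2)) = L" "log_orbit \<delta> l N (2 * ((y + 1) / 2)) = L"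
      by (simp_all only: L_def log_orbit_periodic)
    ultimately have "doubling_op (F (Suc N)) y =
      ((exp (t * (potential \<delta> (y / 2) (log_step \<delta> (y / 2) L) - V))
      + exp (t * (potential \<delta> ((y + 1) / 2) (log_step \<delta> ((y + 1) / 2) L) - V))) / 2) * exp (t * V)"
      unfolding doubling_op_def by (simp add: algebra_simps add_divide_distrib)
    also have "\<dots> \<le> exp R * exp (t * V)"
      unfolding V_def by (intro mult_right_mono step) auto
    finally show ?thesis by (simp add: F_def V_def L_def)
  qed
  have "integral {0..1} (F (Suc N)) = integral {0..1} (doubling_op (F (Suc N)))"
    by (rule integral_doubling_op[symmetric]) (rule cont)
  also have "\<dots> \<le> integral {0..1} (\<lambda>y. exp R * F N y)"
    by (intro Henstock_Kurzweil_Integration.integral_le integrable_continuous_real le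
        continuous_on_subset[OF doubling_op_continuous] continuous_intros cont) auto
  also have "\<dots> = exp R * integral {0..1} (F N)" by simp
  also have "\<dots> \<le> exp R * exp (R * N + B)"
    using Suc.IH by (intro mult_left_mono) (auto simp: F_def)
  also have "\<dots> = exp (R * Suc N + B)" by (simp add: algebra_simps flip: exp_add)
  finally show ?case by (simp add: F_def)
qed

text \<open>A Chernoff bound whose exponent does not depend on \<delta>: the drift and the quadratic
  cost of one step are both of order \<open>\<delta>\<^sup>2\<close>, so a fixed small exponent wins
  and the rate is proportional to \<open>\<delta>\<^sup>2\<close>.\<close>

lemma large_deviations:
  assumes \<eta>: "0 < \<eta>"
  obtains s D \<delta>\<^sub>1 where "0 < s" "1 \<le> D" "0 < \<delta>\<^sub>1" "\<delta>\<^sub>1 \<le> 1"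
    "\<And>\<delta> y \<phi>. 0 < \<delta> \<Longrightarrow> \<delta> \<le> \<delta>\<^sub>1 \<Longrightarrow> cmod (log_increment \<delta> (r y) \<phi>) \<le> 1 / 2"
    "\<And>\<delta> l N. 0 < \<delta> \<Longrightarrow> \<delta> \<le> \<delta>\<^sub>1 \<Longrightarrow> Re l = 0 \<Longrightarrow>
       measure circle {x \<in> space circle. (\<gamma> + \<eta>) * \<delta>\<^sup>2 * real N \<le> Re (log_orbit \<delta> l N x)} \<le> D * exp (- s * \<delta>\<^sup>2 * N)"
    "\<And>\<delta> l N. 0 < \<delta> \<Longrightarrow> \<delta> \<le> \<delta>\<^sub>1 \<Longrightarrow> Re l = 0 \<Longrightarrow>
       measure circle {x \<in> space circle. Re (log_orbit \<delta> l N x) \<le> (\<gamma> - \<eta>) * \<delta>\<^sup>2 * real N} \<le> D * exp (- s * \<delta>\<^sup>2 * N)"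
proof -
  obtain C \<delta>\<^sub>0 where C: "1 \<le> C" and d0: "0 < \<delta>\<^sub>0" "\<delta>\<^sub>0 \<le> 1"
    and small: "\<And>\<delta> y \<phi>. 0 < \<delta> \<Longrightarrow> \<delta> \<le> \<delta>\<^sub>0 \<Longrightarrow> cmod (log_increment \<delta> (r y) \<phi>) \<le> 1 / 2"
    and pot: "\<And>\<delta> y l. 0 < \<delta> \<Longrightarrow> \<delta> \<le> \<delta>\<^sub>0 \<Longrightarrow> \<bar>potential \<delta> y l - Re l\<bar> \<le> C * \<delta>"
    and incr: "\<And>\<delta> y x l. 0 < \<delta> \<Longrightarrow> \<delta> \<le> \<delta>\<^sub>0 \<Longrightarrow> \<bar>potential \<delta> x (log_step \<delta> x l) - potential \<delta> y l\<bar> \<le> C * \<delta>"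
    and main: "\<And>\<delta> y x l. 0 < \<delta> \<Longrightarrow> \<delta> \<le> \<delta>\<^sub>0 \<Longrightarrow>
       \<bar>potential \<delta> x (log_step \<delta> x l) - potential \<delta> y l - (\<delta>\<^sup>2 * \<gamma> + martingale_part \<delta> y x (Im l))\<bar> \<le> C * \<delta> ^ 3"
    using drift by blast
  \<comment> \<open>Chosen so that the quadratic cost \<open>\<tau>\<^sup>2 * C\<^sup>2\<close> is a
    quarter of the available margin \<open>\<tau> * \<eta>\<close>. In
    \<open>\<delta>\<^sub>1\<close> below, \<open>\<eta> / (4 * C)\<close> bounds the third-order
    error by another quarter and \<open>1 / (\<tau> * C)\<close> keeps the exponents within
    [-1, 1].\<close>
  define \<tau> where "\<tau> = \<eta> / (4 * C\<^sup>2)"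
  have \<tau>: "0 < \<tau>" "\<tau>\<^sup>2 * C\<^sup>2 = \<tau> * \<eta> / 4" using \<eta> C by (auto simp: \<tau>_def power2_eq_square field_simps)
  define \<delta>\<^sub>1 where "\<delta>\<^sub>1 = min \<delta>\<^sub>0 (min (\<eta> / (4 * C)) (1 / (\<tau> * C)))"
  have d1: "0 < \<delta>\<^sub>1" "\<delta>\<^sub>1 \<le> \<delta>\<^sub>0" using d0 \<eta> C \<tau> by (auto simp: \<delta>\<^sub>1_def)
  \<comment> \<open>Half of the margin survives as the rate. The potential is exchanged for the real
    part twice, at the start and at the end, each time at a cost of at most
    \<open>exp (\<tau> * C)\<close>.\<close>
  define s D where "s = \<tau> * \<eta> / 2" and "D = exp (2 * \<tau> * C)"
  have chernoff: "measure circle {x \<in> space circle.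
      t * \<gamma> * \<delta>\<^sup>2 * N + \<tau> * \<eta> * \<delta>\<^sup>2 * N \<le> t * Re (log_orbit \<delta> l N x)} \<le> D * exp (- s * \<delta>\<^sup>2 * N)"
    if \<delta>: "0 < \<delta>" "\<delta> \<le> \<delta>\<^sub>1" and l: "Re l = 0" and t: "\<bar>t\<bar> = \<tau>" for \<delta> l t and N :: nat
  proof -
    have \<delta>0: "\<delta> \<le> \<delta>\<^sub>0" "\<delta> \<le> 1" using \<delta> d1 d0 by linarith+
    have "\<delta> \<le> \<eta> / (4 * C)" "\<delta> \<le> 1 / (\<tau> * C)" using \<delta> by (auto simp: \<delta>\<^sub>1_def)
    then have \<delta>C: "C * \<delta> \<le> \<eta> / 4" "\<tau> * (C * \<delta>) \<le> 1" using C \<tau> by (auto simp: field_simps)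
    define R where "R = t * (\<delta>\<^sup>2 * \<gamma>) + \<bar>t\<bar> * (C * \<delta> ^ 3) + t\<^sup>2 * (C * \<delta>)\<^sup>2"
    define A where "A = t * \<gamma> * \<delta>\<^sup>2 * N + \<tau> * \<eta> * \<delta>\<^sup>2 * N"
    have sm: "cmod (log_increment \<delta> (r y) \<phi>) \<le> 1 / 2" for y \<phi> by (rule small[OF \<delta>(1) \<delta>0(1)])
    have B: "\<bar>t * potential \<delta> x l' - t * Re l'\<bar> \<le> \<tau> * C" for x l'
    proof -
      have "\<bar>t * (potential \<delta> x l' - Re l')\<bar> \<le> \<tau> * (C * \<delta>)"
        unfolding abs_mult t using pot[OF \<delta>(1) \<delta>0(1)] \<tau> by (intro mult_left_mono) auto
      also have "\<dots> \<le> \<tau> * (C * 1)" using \<delta>0 C \<tau> by (intro mult_left_mono) auto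
      finally show ?thesis by (simp add: right_diff_distrib)
    qed
    have mom: "integral {0..1} (\<lambda>x. exp (t * potential \<delta> x (log_orbit \<delta> l N x))) \<le> exp (R * N + \<tau> * C)"
    proof (rule moment_bound[OF sm])
      fix y l
      define a b where "a = potential \<delta> (y / 2) (log_step \<delta> (y / 2) l) - potential \<delta> y l"
        and "b = potential \<delta> ((y + 1) / 2) (log_step \<delta> ((y + 1) / 2) l) - potential \<delta> y l"
      have "\<bar>(a + b) / 2 - m\<bar> \<le> e"
        if "\<bar>a - (m + p)\<bar> \<le> e" "\<bar>b - (m + q)\<bar> \<le> e" "p + q = 0" for m p q e
        using that by (auto simp: abs_le_iff field_simps)
      from this[OF _ _ martingale_part_centered[of \<delta> y "Im l"]]
      have "\<bar>(a + b) / 2 - \<delta>\<^sup>2 * \<gamma>\<bar> \<le> C * \<delta> ^ 3"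
        using main[OF \<delta>(1) \<delta>0(1)] unfolding a_def b_def by blast
      then show "(exp (t * a) + exp (t * b)) / 2 \<le> exp R"
        unfolding R_def using incr[OF \<delta>(1) \<delta>0(1)] \<delta>C t
        by (intro exp_average_le) (auto simp: a_def b_def)
    next
      show "t * potential \<delta> x l \<le> \<tau> * C" for x using B[of x l] l by simp
    qed
    have cont: "continuous_on UNIV (\<lambda>x. exp (t * Re (log_orbit \<delta> l N x)))"
      by (intro continuous_intros log_orbit_continuous sm)
    have "integral {0..1} (\<lambda>x. exp (t * Re (log_orbit \<delta> l N x)))
        \<le> integral {0..1} (\<lambda>x. exp (\<tau> * C) * exp (t * potential \<delta> x (log_orbit \<delta> l N x)))"
    proof (intro Henstock_Kurzweil_Integration.integral_le integrable_continuous_real)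
      show "continuous_on {0..1} (\<lambda>x. exp (\<tau> * C) * exp (t * potential \<delta> x (log_orbit \<delta> l N x)))"
        by (intro continuous_intros continuous_on_subset[OF potential_continuous] log_orbit_continuous sm) auto
      fix x :: real
      show "exp (t * Re (log_orbit \<delta> l N x)) \<le> exp (\<tau> * C) * exp (t * potential \<delta> x (log_orbit \<delta> l N x))"
        using B[of x "log_orbit \<delta> l N x"] by (simp add: abs_le_iff flip: exp_add)
    qed (rule continuous_on_subset[OF cont], simp)
    also have "\<dots> \<le> exp (\<tau> * C) * exp (R * N + \<tau> * C)" using mom by simp
    finally have int: "integral {0..1} (\<lambda>x. exp (t * Re (log_orbit \<delta> l N x))) \<le> exp (R * N + 2 * \<tau> * C)"
      by (simp add: algebra_simps flip: exp_add)
    have "measure circle {x \<in> space circle. A \<le> t * Re (log_orbit \<delta> l N x)}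
       = measure circle {x \<in> space circle. exp A \<le> exp (t * Re (log_orbit \<delta> l N x))}" by simp
    also have "\<dots> \<le> integral {0..1} (\<lambda>x. exp (t * Re (log_orbit \<delta> l N x))) / exp A"
      by (rule circle_markov[OF cont]) auto
    also have "\<dots> \<le> exp (R * N + 2 * \<tau> * C) / exp A" using int by (simp add: divide_right_mono)
    also have "\<dots> = exp (R * N + 2 * \<tau> * C - A)" by (simp add: exp_diff)
    also have "\<dots> \<le> exp (2 * \<tau> * C + - s * \<delta>\<^sup>2 * N)"
    proof -
      have "\<tau> * (C * \<delta> ^ 3) = \<tau> * \<delta>\<^sup>2 * (C * \<delta>)" by (simp add: power2_eq_square power3_eq_cube)
      also have "\<dots> \<le> \<tau> * \<delta>\<^sup>2 * (\<eta> / 4)" using \<tau> \<delta>C by (intro mult_left_mono) auto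
      finally have "\<tau> * (C * \<delta> ^ 3) \<le> \<tau> * \<eta> / 4 * \<delta>\<^sup>2" by (simp add: mult_ac)
      moreover have "t\<^sup>2 * (C * \<delta>)\<^sup>2 = \<tau> * \<eta> / 4 * \<delta>\<^sup>2"
        using \<tau>(2) t by (metis (no_types) mult.assoc power2_abs power_mult_distrib)
      ultimately have "R \<le> t * \<gamma> * \<delta>\<^sup>2 + \<tau> * \<eta> / 2 * \<delta>\<^sup>2" unfolding R_def t by (simp add: mult_ac)
      then have "R * N \<le> (t * \<gamma> * \<delta>\<^sup>2 + \<tau> * \<eta> / 2 * \<delta>\<^sup>2) * N" by (intro mult_right_mono) auto
      then show ?thesis by (simp add: A_def s_def algebra_simps)
    qed
    finally show ?thesis by (simp add: A_def D_def flip: exp_add)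
  qed
  show ?thesis
  proof (rule that[of s D \<delta>\<^sub>1])
    show "0 < s" "1 \<le> D" "0 < \<delta>\<^sub>1" "\<delta>\<^sub>1 \<le> 1" using \<tau> \<eta> C d1 d0 by (auto simp: s_def D_def)
    show "cmod (log_increment \<delta> (r y) \<phi>) \<le> 1 / 2" if "0 < \<delta>" "\<delta> \<le> \<delta>\<^sub>1" for \<delta> y \<phi>
      using that d1 by (intro small) auto
  next
    fix \<delta> l and N :: nat assume *: "0 < \<delta>" "\<delta> \<le> \<delta>\<^sub>1" "Re l = 0"
    have "(\<gamma> + \<eta>) * \<delta>\<^sup>2 * N \<le> z \<longleftrightarrow> \<tau> * \<gamma> * \<delta>\<^sup>2 * N + \<tau> * \<eta> * \<delta>\<^sup>2 * N \<le> \<tau> * z" for z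
      using \<tau>(1) mult_le_cancel_left_pos[of \<tau> "(\<gamma> + \<eta>) * \<delta>\<^sup>2 * N" z] by (simp add: algebra_simps)
    then show "measure circle {x \<in> space circle. (\<gamma> + \<eta>) * \<delta>\<^sup>2 * real N \<le> Re (log_orbit \<delta> l N x)} \<le> D * exp (- s * \<delta>\<^sup>2 * N)"
      using chernoff[OF *, of \<tau> N] \<tau> by simp
    have "z \<le> (\<gamma> - \<eta>) * \<delta>\<^sup>2 * N \<longleftrightarrow> - \<tau> * \<gamma> * \<delta>\<^sup>2 * N + \<tau> * \<eta> * \<delta>\<^sup>2 * N \<le> - \<tau> * z" for z
      using \<tau>(1) mult_le_cancel_left_pos[of \<tau> z "(\<gamma> - \<eta>) * \<delta>\<^sup>2 * N"] by (simp add: algebra_simps)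
    then show "measure circle {x \<in> space circle. Re (log_orbit \<delta> l N x) \<le> (\<gamma> - \<eta>) * \<delta>\<^sup>2 * real N} \<le> D * exp (- s * \<delta>\<^sup>2 * N)"
      using chernoff[OF *, of "- \<tau>" N] \<tau> by simp
  qed
qed

end

section \<open>Reduction of the transfer matrices\<close>

text \<open>The derivative inherits the period and is continuous, so its bound on one period is
  global.\<close>

lemma C1_circle_lipschitz:
  assumes "C1_circle a"
  obtains C where "circle_lipschitz C a"
proof -
  have per: "a (x + 1) = a x" for x using assms by (auto simp: C1_circle_def)
  obtain D where D: "\<And>x. (a has_real_derivative D x) (at x)" and cD: "continuous_on UNIV D"
    using assms by (auto simp: C1_circle_def C1_differentiable_on_def has_real_derivative_iff_has_vector_derivative)
  have D_per: "D (x + 1) = D x" for x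
  proof -
    have "((\<lambda>x. a (x + 1)) has_real_derivative D (x + 1)) (at x)"
      using D[of "x + 1"] DERIV_shift by blast
    then show ?thesis using DERIV_unique[OF D[of x]] per by auto
  qed
  have "compact (D ` {0..1})" by (intro compact_continuous_image continuous_on_subset[OF cD]) auto
  then obtain B where B: "\<And>x. x \<in> {0..1} \<Longrightarrow> \<bar>D x\<bar> \<le> B"
    using compact_imp_bounded[of "D ` {0..1}"] by (force simp: bounded_iff)
  have B': "\<bar>D x\<bar> \<le> B" for x
    using B[of "frac x"] periodic_frac[of D x] D_per frac_lt_1[of x] by auto
  have "\<bar>a x - a y\<bar> \<le> B * \<bar>x - y\<bar>" for x y
    using field_differentiable_bound[of UNIV a D B x y] D B' by auto
  moreover have "0 \<le> B" using B'[of 0] by linarith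
  ultimately have "circle_lipschitz B a"
    using per by (auto simp: circle_lipschitz_def lipschitz_on_def dist_real_def)
  then show ?thesis by (rule that)
qed

lemma circle_lipschitz_inverse:
  assumes a: "circle_lipschitz C a" and m: "0 < m" "\<And>x. m \<le> a x"
  shows "circle_lipschitz (C / m\<^sup>2) (\<lambda>x. inverse (a x))"
proof -
  have pos: "0 < a x" for x using m(1) m(2)[of x] by linarith
  have "\<bar>inverse (a x) - inverse (a y)\<bar> \<le> C / m\<^sup>2 * \<bar>x - y\<bar>" for x y
  proof -
    have "inverse (a x) - inverse (a y) = (a y - a x) / (a x * a y)"
      using pos[of x] pos[of y] by (simp add: field_simps)
    then have "\<bar>inverse (a x) - inverse (a y)\<bar> = \<bar>a y - a x\<bar> / (a x * a y)"
      using pos[of x] pos[of y] by (simp add: abs_mult)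
    also have "\<dots> \<le> (C * \<bar>x - y\<bar>) / (m * m)"
      using m pos circle_lipschitzD[OF a, of y x]
      by (intro frac_le mult_mono) (auto simp: abs_minus_commute less_imp_le intro: order.trans[of 0 m])
    finally show ?thesis by (simp add: power2_eq_square)
  qed
  moreover have "0 \<le> C / m\<^sup>2" using circle_lipschitz_nonneg[OF a] by simp
  ultimately show ?thesis
    using a by (auto simp: circle_lipschitz_def lipschitz_on_def dist_real_def)
qed

lemma circle_lipschitz_affine:
  assumes "circle_lipschitz C f"
  shows "circle_lipschitz (\<bar>c\<bar> * C) (\<lambda>x. c * f x + d)"
proof -
  have "\<bar>c * f x + d - (c * f y + d)\<bar> \<le> \<bar>c\<bar> * C * \<bar>x - y\<bar>" for x y
    using mult_left_mono[OF circle_lipschitzD[OF assms, of x y], of "\<bar>c\<bar>"]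
    by (simp add: abs_mult[symmetric] algebra_simps)
  then show ?thesis using assms circle_lipschitz_nonneg[OF assms]
    by (auto simp: circle_lipschitz_def lipschitz_on_def dist_real_def)
qed

text \<open>The prescribed value of \<gamma> is precisely the one for which the right-hand side
  \<open>k\<close> of the third Poisson equation has mean zero.\<close>

lemma exists_phase_drift:
  assumes r: "circle_lipschitz C r" "integral {0..1} r = 0"
    and \<gamma>: "8 * \<gamma> = integral {0..1} (\<lambda>x. (r x)\<^sup>2) + 2 * (\<Sum>s. integral {0..1} (\<lambda>x. r x * r (2 ^ Suc s * x)))"
  obtains G K J M where "phase_drift r G K J \<gamma> M"
proof -
  define G where "G = poisson r"
  have G: "circle_lipschitz C G" "integral {0..1} G = 0"
    unfolding G_def by (rule circle_lipschitz_poisson[OF r]) (rule integral_poisson[OF r])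
  define K where "K = poisson G"
  have K: "circle_lipschitz C K" unfolding K_def by (rule circle_lipschitz_poisson[OF G])
  obtain C1 C2 where "circle_lipschitz C1 (\<lambda>x. r x * r x)" and rG: "circle_lipschitz C2 (\<lambda>x. r x * G x)"
    using circle_lipschitz_mult[OF r(1) r(1)] circle_lipschitz_mult[OF r(1) G(1)] by blast
  then have rr: "circle_lipschitz C1 (\<lambda>x. (r x)\<^sup>2)" by (simp add: power2_eq_square)
  define k where "k = (\<lambda>x. (r x)\<^sup>2 / 2 + r x * G x - 4 * \<gamma>)"
  have "circle_lipschitz (\<bar>1 / 2\<bar> * C1 + (\<bar>1\<bar> * C2)) (\<lambda>x. ((1 / 2) * (r x)\<^sup>2 + 0) + (1 * (r x * G x) + (- 4 * \<gamma>)))"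
    by (intro circle_lipschitz_add circle_lipschitz_affine rr rG)
  then have k: "circle_lipschitz (\<bar>1 / 2\<bar> * C1 + (\<bar>1\<bar> * C2)) k" by (simp add: k_def algebra_simps)
  have "integral {0..1} k = integral {0..1} (\<lambda>x. (r x)\<^sup>2) / 2 + integral {0..1} (\<lambda>x. r x * G x) - 4 * \<gamma>"
  proof -
    have i: "(\<lambda>x. (r x)\<^sup>2) integrable_on {0..1}" "(\<lambda>x. r x * G x) integrable_on {0..1}"
      by (intro integrable_continuous_real circle_lipschitz_continuous[OF rr] circle_lipschitz_continuous[OF rG])+
    have "(k has_integral (integral {0..1} (\<lambda>x. (r x)\<^sup>2) / 2 + integral {0..1} (\<lambda>x. r x * G x) - 4 * \<gamma>)) {0..1}"
      unfolding k_def using has_integral_const_real[of "4 * \<gamma>" 0 1] i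
      by (intro has_integral_add has_integral_diff has_integral_divide) (auto simp: has_integral_integral)
    then show ?thesis by (rule integral_unique)
  qed
  moreover have "(\<Sum>s. integral {0..1} (\<lambda>x. r x * r (2 ^ Suc s * x))) = integral {0..1} (\<lambda>x. r x * G x)"
    unfolding G_def by (rule sums_unique[OF integral_mult_poisson[OF r], symmetric])
  ultimately have k0: "integral {0..1} k = 0" using \<gamma> by simp
  define J where "J = poisson k"
  have J: "circle_lipschitz (\<bar>1 / 2\<bar> * C1 + (\<bar>1\<bar> * C2)) J" unfolding J_def by (rule circle_lipschitz_poisson[OF k k0])
  obtain M1 M2 M3 M4 where M: "\<And>x. \<bar>r x\<bar> \<le> M1" "\<And>x. \<bar>G x\<bar> \<le> M2" "\<And>x. \<bar>K x\<bar> \<le> M3" "\<And>x. \<bar>J x\<bar> \<le> M4"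
    using r(1) G(1) K J circle_lipschitz_bounded by metis
  define M where "M = Max {1, M1, M2, M3, M4}"
  have "phase_drift r G K J \<gamma> M"
  proof
    have "1 \<le> M" "M1 \<le> M" "M2 \<le> M" "M3 \<le> M" "M4 \<le> M" by (auto simp: M_def)
    then show "1 \<le> M" "\<bar>r y\<bar> \<le> M" "\<bar>G y\<bar> \<le> M" "\<bar>K y\<bar> \<le> M" "\<bar>J y\<bar> \<le> M" for y
      using M order.trans by blast+
    show "doubling_op (\<lambda>x. r x + G x) y = G y" for y unfolding G_def by (rule poisson_equation[OF r])
    show "doubling_op (\<lambda>x. G x + K x) y = K y" for y unfolding K_def by (rule poisson_equation[OF G])
    show "doubling_op (\<lambda>x. (r x)\<^sup>2 / 2 + r x * G x - 4 * \<gamma> + J x) y = J y" for y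
      using poisson_equation[OF k k0, of y] unfolding J_def k_def .
    show "r (y + 1) = r y" for y using r(1) by (auto simp: circle_lipschitz_def)
  qed (intro circle_lipschitz_continuous[OF r(1)] circle_lipschitz_continuous[OF G(1)]
      circle_lipschitz_continuous[OF K] circle_lipschitz_continuous[OF J])+
  then show ?thesis by (rule that)
qed

text \<open>The step \<psi>_j = \<psi>_(j-1) + p_j / a_j, p_(j+1) = p_j - E \<psi>_j in the
  variables \<psi>_(j-1) and p_j / sqrt (E \<kappa>), with 1 - \<rho> = \<kappa> / a_j. Here \<rho>
  is a value of \<open>r\<close>.\<close>

definition phase_matrix :: "real \<Rightarrow> real \<Rightarrow> real^2^2" where
  "phase_matrix \<delta> \<rho> = vector [vector [1, \<delta> * (1 - \<rho>)], vector [- \<delta>, 1 - \<delta>\<^sup>2 * (1 - \<rho>)]]"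

primrec phase_product :: "real \<Rightarrow> (real \<Rightarrow> real) \<Rightarrow> nat \<Rightarrow> real \<Rightarrow> real^2^2" where
  "phase_product \<delta> r 0 x = mat 1"
| "phase_product \<delta> r (Suc N) x = phase_product \<delta> r N (2 * x) ** phase_matrix \<delta> (r x)"

lemmas matrix_2_simps = vec_eq_iff forall_2 matrix_matrix_mult_def sum_2 vector_2 mat_def

text \<open>Splitting off the rightmost factor leaves the product along the orbit of
  \<open>2 * x\<close>, which turns the forward definition into the backward recursion of
  \<open>phase_product\<close>.\<close>

lemma transfer_matrix_Suc_shift:
  "transfer_matrix a E (Suc N) x = transfer_matrix a E N (2 * x) ** step_matrix a E 0 x"
proof (induction N)
  case 0
  then show ?case by simp
next
  case (Suc N)
  have o: "orbit_seq a (Suc n) x = orbit_seq a n (2 * x)" for n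
    by (simp add: orbit_seq_def mult_ac)
  have "step_matrix a E (Suc N) x = step_matrix a E N (2 * x)" by (simp add: step_matrix_def o)
  then have "transfer_matrix a E (Suc (Suc N)) x = step_matrix a E N (2 * x) ** transfer_matrix a E (Suc N) x"
    by (simp only: transfer_matrix.simps(2))
  also have "\<dots> = step_matrix a E N (2 * x) ** (transfer_matrix a E N (2 * x) ** step_matrix a E 0 x)"
    by (simp only: Suc.IH)
  also have "\<dots> = transfer_matrix a E (Suc N) (2 * x) ** step_matrix a E 0 x"
    by (simp only: transfer_matrix.simps(2) matrix_mul_assoc)
  finally show ?case .
qed

text \<open>The last factor sends (a_j \<psi>_j, \<psi>_(j-1)) to (\<psi>_(j-1), p_j / sqrt (E
  \<kappa>)), and the first is the inverse of the same change of variables at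
  \<open>2 ^ N * x\<close>. All intermediate changes of variables cancel.\<close>

lemma transfer_matrix_conjugation:
  assumes per: "\<And>x. a (x + 1) = a x" and pos: "\<And>x. 0 < a x" and k: "0 < \<kappa>" "0 < E"
    and r: "\<And>x. r x = 1 - \<kappa> / a x"
  shows "transfer_matrix a E N x =
    vector [vector [a (2 ^ N * x), sqrt (E * \<kappa>)], vector [1, 0]] **
      phase_product (sqrt (E / \<kappa>)) r N x **
      vector [vector [0, 1], vector [1 / sqrt (E * \<kappa>), - a x / sqrt (E * \<kappa>)]]"
proof (induction N arbitrary: x)
  case 0
  have "a x * (1 / a x) = 1" using pos[of x] by simp
  then show ?case using k by (simp add: matrix_2_simps)
next
  case (Suc N)
  define w \<delta> where "w = sqrt (E * \<kappa>)" and "\<delta> = sqrt (E / \<kappa>)"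
  have w: "0 < w" using k by (simp add: w_def)
  have \<delta>\<kappa>: "\<delta> * \<kappa> = w"
  proof -
    have "\<delta> * \<kappa> = sqrt E * (\<kappa> / sqrt \<kappa>)" by (simp add: \<delta>_def real_sqrt_divide)
    also have "\<dots> = w" using k by (simp add: w_def real_sqrt_mult real_div_sqrt)
    finally show ?thesis .
  qed
  have \<delta>w: "\<delta> * w = E" using k by (simp add: w_def \<delta>_def flip: real_sqrt_mult)
  have \<delta>2: "\<delta>\<^sup>2 * \<kappa> = E" using \<delta>\<kappa> \<delta>w by (metis mult.assoc power2_eq_square)
  define C :: "real \<Rightarrow> real^2^2" where "C = (\<lambda>x. vector [vector [0, 1], vector [1 / w, - a x / w]])"
  have o: "orbit_seq a 0 x = a x" "orbit_seq a (Suc 0) x = a (2 * x)"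
    using periodic_frac[of a, OF per] by (auto simp: orbit_seq_def)
  have ax: "a x \<noteq> 0" using pos[of x] by simp
  have b1: "\<delta> * (1 - r x) = w / a x" unfolding r using \<delta>\<kappa> by simp
  have b2: "\<delta>\<^sup>2 * (1 - r x) = E / a x" unfolding r using \<delta>2 by simp
  have \<delta>': "\<delta> = E / w" using \<delta>w w by (simp add: field_simps)
  \<comment> \<open>The intertwining relation behind the cancellation: the change of variables at
    \<open>2 * x\<close> after one original step equals one phase step after the change of variables
    at \<open>x\<close>.\<close>
  have CB: "C (2 * x) ** step_matrix a E 0 x = phase_matrix \<delta> (r x) ** C x"
    unfolding C_def step_matrix_def phase_matrix_def b1 b2 o unfolding \<delta>'
    using ax w by (simp add: matrix_2_simps field_simps power2_eq_square)
  define L :: "real^2^2" where "L = vector [vector [a (2 ^ N * (2 * x)), w], vector [1, 0]]"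
  have "transfer_matrix a E (Suc N) x = transfer_matrix a E N (2 * x) ** step_matrix a E 0 x"
    by (rule transfer_matrix_Suc_shift)
  also have "transfer_matrix a E N (2 * x) = L ** phase_product \<delta> r N (2 * x) ** C (2 * x)"
    unfolding L_def C_def w_def \<delta>_def by (rule Suc.IH)
  also have "\<dots> ** step_matrix a E 0 x = L ** phase_product \<delta> r N (2 * x) ** (C (2 * x) ** step_matrix a E 0 x)"
    by (simp only: matrix_mul_assoc)
  also have "\<dots> = L ** phase_product \<delta> r (Suc N) x ** C x"
    by (simp only: CB phase_product.simps matrix_mul_assoc)
  also have "2 ^ N * (2 * x) = 2 ^ Suc N * x" by simp
  then have "L = vector [vector [a (2 ^ Suc N * x), w], vector [1, 0]]" by (simp only: L_def)
  finally show ?case by (simp only: C_def w_def \<delta>_def)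
qed

context phase_drift
begin

lemma exp_log_step:
  assumes "cmod (log_increment \<delta> (r y) (Im l)) \<le> 1 / 2"
  shows "Re (exp (log_step \<delta> y l)) = Re (exp l) - \<delta> * Im (exp l)"
    and "Im (exp (log_step \<delta> y l)) = \<delta> * (1 - r y) * Re (exp l) + (1 - \<delta>\<^sup>2 * (1 - r y)) * Im (exp l)"
proof -
  define c s where "c = cos (Im l)" and "s = sin (Im l)"
  have cs: "c\<^sup>2 = 1 - s\<^sup>2" by (simp add: c_def s_def cos_squared_eq)
  have "1 + log_increment \<delta> (r y) (Im l) \<noteq> 0"
    using one_plus_nonpos[OF assms] by auto
  then have e: "exp (log_step \<delta> y l) = exp l * (1 + log_increment \<delta> (r y) (Im l))"
    by (simp add: log_step_def exp_add)
  have l: "Re (exp l) = exp (Re l) * c" "Im (exp l) = exp (Re l) * s" by (auto simp: Re_exp Im_exp c_def s_def)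
  show "Re (exp (log_step \<delta> y l)) = Re (exp l) - \<delta> * Im (exp l)"
    unfolding e log_increment_def by (simp add: l c_def[symmetric] s_def[symmetric] power2_eq_square algebra_simps)
  have "Im (exp (log_step \<delta> y l)) = exp (Re l) * (c * (\<delta> * (1 - r y * c\<^sup>2) - \<delta>\<^sup>2 * (1 - r y) * s * c)
      + s * (1 + (- \<delta> * r y * c * s - \<delta>\<^sup>2 * (1 - r y) * s\<^sup>2)))"
    unfolding e log_increment_def by (simp add: l c_def[symmetric] s_def[symmetric] algebra_simps)
  also have "c * (\<delta> * (1 - r y * c\<^sup>2) - \<delta>\<^sup>2 * (1 - r y) * s * c)
      + s * (1 + (- \<delta> * r y * c * s - \<delta>\<^sup>2 * (1 - r y) * s\<^sup>2))
    = \<delta> * c * (1 - r y * (c\<^sup>2 + s\<^sup>2)) + s * (1 - \<delta>\<^sup>2 * (1 - r y) * (c\<^sup>2 + s\<^sup>2))"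
    by (simp add: power2_eq_square algebra_simps)
  also have "\<dots> = \<delta> * c * (1 - r y) + s * (1 - \<delta>\<^sup>2 * (1 - r y))" by (simp add: cs)
  finally show "Im (exp (log_step \<delta> y l)) = \<delta> * (1 - r y) * Re (exp l) + (1 - \<delta>\<^sup>2 * (1 - r y)) * Im (exp l)"
    by (simp add: l algebra_simps)
qed

text \<open>Right multiplication acts on each row separately. The rows (1, 0) and (0, 1) of the
  identity are the exponentials of \<open>l = 0\<close> and
  \<open>l = \<i> * pi / 2\<close>.\<close>

lemma phase_product_row:
  assumes small: "\<And>y \<phi>. cmod (log_increment \<delta> (r y) \<phi>) \<le> 1 / 2"
    and init: "mat 1 $ i = (vector [Re (exp l), Im (exp l)] :: real^2)"
  shows "phase_product \<delta> r N x $ i =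
    vector [Re (exp (log_orbit \<delta> l N x)), Im (exp (log_orbit \<delta> l N x))]"
proof (induction N arbitrary: x)
  case 0
  then show ?case using init by simp
next
  case (Suc N)
  show ?case
    unfolding phase_product.simps log_orbit.simps exp_log_step[OF small]
    by (simp add: vec_eq_iff forall_2 matrix_matrix_mult_def sum_2 phase_matrix_def Suc.IH algebra_simps)
qed

end

section \<open>Comparison of the operator norm with the rows\<close>

lemma abs_component_le_onorm:
  fixes A :: "real^'n^'m"
  shows "\<bar>A $ i $ j\<bar> \<le> onorm ((*v) A)"
proof -
  have "\<bar>A $ i $ j\<bar> = \<bar>(A *v axis j 1) $ i\<bar>" by (simp add: matrix_vector_mult_basis column_def)
  also have "\<dots> \<le> norm (A *v axis j 1)" by (rule component_le_norm_cart)
  also have "\<dots> \<le> onorm ((*v) A) * norm (axis j 1 :: real^'n)" by (intro onorm) simp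
  finally show ?thesis by simp
qed

lemma onorm_le_component_sum:
  fixes A :: "real^2^2"
  shows "onorm ((*v) A) \<le> \<bar>A $ 1 $ 1\<bar> + \<bar>A $ 1 $ 2\<bar> + \<bar>A $ 2 $ 1\<bar> + \<bar>A $ 2 $ 2\<bar>"
  using onorm_le_matrix_component_sum[of A] by (simp add: sum_2)

text \<open>The second row of \<open>T\<close> involves only the first row of \<open>B\<close>, so
  that row alone bounds the norm from below, while the upper bound uses all entries. The factor
  \<open>1 / w\<close> is harmless: the constants may depend on \<open>E\<close>, as
  \<open>N\<close> is taken large afterwards.\<close>

lemma conjugation_norm_bounds:
  fixes B :: "real^2^2"
  assumes w: "0 < w" and A: "\<bar>\<alpha>\<bar> \<le> A" "\<bar>\<beta>\<bar> \<le> A"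
  defines "T \<equiv> vector [vector [\<alpha>, w], vector [1, 0]] ** B ** vector [vector [0, 1], vector [1 / w, - \<beta> / w]] :: real^2^2"
  shows "\<bar>B $ 1 $ 1\<bar> + \<bar>B $ 1 $ 2\<bar> \<le> (1 + A + w) * onorm ((*v) T)"
    and "onorm ((*v) T) \<le> (2 + 2 * A + w + (1 + A)\<^sup>2 / w) * (\<bar>B $ 1 $ 1\<bar> + \<bar>B $ 1 $ 2\<bar> + \<bar>B $ 2 $ 1\<bar> + \<bar>B $ 2 $ 2\<bar>)"
proof -
  define n where "n = onorm ((*v) T)"
  have A0: "0 \<le> A" using A by linarith
  define b11 b12 b21 b22 where b: "b11 = B $ 1 $ 1" "b12 = B $ 1 $ 2" "b21 = B $ 2 $ 1" "b22 = B $ 2 $ 2"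
  have T: "T $ 1 $ 1 = \<alpha> * b12 / w + b22" "T $ 1 $ 2 = \<alpha> * b11 + w * b21 - \<alpha> * \<beta> * b12 / w - \<beta> * b22"
    "T $ 2 $ 1 = b12 / w" "T $ 2 $ 2 = b11 - \<beta> * b12 / w"
    using w by (simp_all add: T_def matrix_matrix_mult_def sum_2 vector_2 b field_simps)
  have n: "\<bar>T $ i $ j\<bar> \<le> n" for i j unfolding n_def by (rule abs_component_le_onorm)
  have "b12 = w * T $ 2 $ 1" "b11 = T $ 2 $ 2 + \<beta> * T $ 2 $ 1" using w by (simp_all add: T)
  then have "\<bar>b11\<bar> + \<bar>b12\<bar> \<le> \<bar>T $ 2 $ 2\<bar> + \<bar>\<beta>\<bar> * \<bar>T $ 2 $ 1\<bar> + w * \<bar>T $ 2 $ 1\<bar>"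
    using w abs_triangle_ineq[of "T $ 2 $ 2" "\<beta> * T $ 2 $ 1"] by (simp add: abs_mult)
  also have "\<dots> \<le> n + A * n + w * n"
    using w A A0 by (intro add_mono mult_mono n) auto
  finally show "\<bar>B $ 1 $ 1\<bar> + \<bar>B $ 1 $ 2\<bar> \<le> (1 + A + w) * onorm ((*v) T)"
    by (simp add: n_def b algebra_simps)
  define S where "S = \<bar>b11\<bar> + \<bar>b12\<bar> + \<bar>b21\<bar> + \<bar>b22\<bar>"
  have S: "\<bar>b11\<bar> \<le> S" "\<bar>b12\<bar> \<le> S" "\<bar>b21\<bar> \<le> S" "\<bar>b22\<bar> \<le> S" "0 \<le> S" by (auto simp: S_def)
  have 1: "\<bar>x * y\<bar> \<le> A * S" if "\<bar>x\<bar> \<le> A" "\<bar>y\<bar> \<le> S" for x y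
    unfolding abs_mult using that A0 by (intro mult_mono) auto
  have 2: "\<bar>x * y / w\<bar> \<le> A * S / w" if "\<bar>x\<bar> \<le> A" "\<bar>y\<bar> \<le> S" for x y
    using 1[OF that] w by (simp add: abs_mult divide_right_mono)
  have 3: "\<bar>\<alpha> * \<beta> * b12 / w\<bar> \<le> A * A * S / w"
    unfolding abs_divide abs_mult using A A0 S w by (intro divide_mono mult_mono) auto
  have 4: "\<bar>w * b21\<bar> \<le> w * S" using w S by (simp add: abs_mult)
  have 5: "\<bar>b12 / w\<bar> \<le> S / w" using w S by (simp add: divide_right_mono)
  have "onorm ((*v) T) \<le> \<bar>T $ 1 $ 1\<bar> + \<bar>T $ 1 $ 2\<bar> + \<bar>T $ 2 $ 1\<bar> + \<bar>T $ 2 $ 2\<bar>"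
    by (rule onorm_le_component_sum)
  also have "\<dots> \<le> (A * S / w + S) + (A * S + w * S + A * A * S / w + A * S) + S / w + (S + A * S / w)"
  proof (intro add_mono)
    show "\<bar>T $ 1 $ 1\<bar> \<le> A * S / w + S" unfolding T using 2[OF A(1) S(2)] S(4) by linarith
    show "\<bar>T $ 1 $ 2\<bar> \<le> A * S + w * S + A * A * S / w + A * S"
      unfolding T using 1[OF A(1) S(1)] 1[OF A(2) S(4)] 3 4 by linarith
    show "\<bar>T $ 2 $ 1\<bar> \<le> S / w" unfolding T by (rule 5)
    show "\<bar>T $ 2 $ 2\<bar> \<le> S + A * S / w" unfolding T using 2[OF A(2) S(2)] S(1) by linarith
  qed
  also have "\<dots> = (2 + 2 * A + w + (1 + A)\<^sup>2 / w) * S"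
    using w by (simp add: field_simps power2_eq_square)
  finally show "onorm ((*v) T) \<le> (2 + 2 * A + w + (1 + A)\<^sup>2 / w) * (\<bar>B $ 1 $ 1\<bar> + \<bar>B $ 1 $ 2\<bar> + \<bar>B $ 2 $ 1\<bar> + \<bar>B $ 2 $ 2\<bar>)"
    by (simp add: S_def b)
qed

lemma finite_measure_circle: "finite_measure circle"
  unfolding circle_def by (intro finite_measure_lebesgue_on bounded_set_imp_lmeasurable) auto

lemma C1_circle_lower_bound:
  assumes per: "\<And>x. a (x + 1) = a x" and inf: "0 < (INF x. ereal (a x))"
  obtains m where "0 < m" "\<And>x. m \<le> a x"
proof -
  obtain m where m: "0 < ereal m" "ereal m < (INF x. ereal (a x))" using ereal_dense2[OF inf] by auto
  have "m \<le> a x" for x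
    using m(2) INF_lower[of x UNIV "\<lambda>x. ereal (a x)"] by (metis UNIV_I ereal_less_eq(3) less_imp_le order.trans)
  then show ?thesis using that m by simp
qed

text \<open>The normalisation by \<open>kappa a\<close> makes \<open>r\<close> centred. Since
  \<open>q_fun a\<close> is \<open>r\<close> divided by \<open>kappa a\<close>, the prefactor of
  \<open>c_coeff a\<close> leaves \<open>kappa a * c_coeff a\<close> as one eighth of the
  correlation sum of \<open>r\<close>.\<close>

lemma circle_data:
  assumes a: "circle_lipschitz C a" and m: "0 < m" "\<And>x. m \<le> a x"
    and r_def: "r = (\<lambda>x. 1 - kappa a / a x)"
  obtains D where "0 < kappa a" "circle_lipschitz D r" "integral {0..1} r = 0"
    "8 * (kappa a * c_coeff a) = integral {0..1} (\<lambda>x. (r x)\<^sup>2) + 2 * (\<Sum>s. integral {0..1} (\<lambda>x. r x * r (2 ^ Suc s * x)))"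
proof -
  define b where "b = (\<lambda>x. inverse (a x))"
  define \<kappa> where "\<kappa> = kappa a"
  have b: "circle_lipschitz (C / m\<^sup>2) b" unfolding b_def by (rule circle_lipschitz_inverse[OF a m])
  note cb = circle_lipschitz_continuous[OF b]
  obtain M where M: "\<And>x. \<bar>a x\<bar> \<le> M" using circle_lipschitz_bounded[OF a] by blast
  have M0: "0 < M" using M[of 0] m(1) m(2)[of 0] by linarith
  have low: "inverse M \<le> b x" for x
    unfolding b_def using m(1) m(2)[of x] M[of x] by (intro le_imp_inverse_le) auto
  have "integral {0..1::real} (\<lambda>x. inverse M) \<le> integral {0..1} b"
    by (intro Henstock_Kurzweil_Integration.integral_le integrable_continuous_real cb low) auto
  then have I: "0 < integral {0..1} b" using M0 by (simp, smt (verit) positive_imp_inverse_positive)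
  have \<kappa>: "\<kappa> = inverse (integral {0..1} b)"
    using integral_circle(2)[OF cb] by (simp add: \<kappa>_def kappa_def b_def)
  then have \<kappa>0: "0 < \<kappa>" "\<kappa> * integral {0..1} b = 1" using I by auto
  have r_b: "r = (\<lambda>x. - \<kappa> * b x + 1)" by (auto simp: r_def b_def \<kappa>_def field_simps)
  have r: "circle_lipschitz (\<bar>- \<kappa>\<bar> * (C / m\<^sup>2)) r" unfolding r_b by (rule circle_lipschitz_affine[OF b])
  note cr = circle_lipschitz_continuous[OF r]
  have "((\<lambda>x. - \<kappa> * b x + 1) has_integral (- \<kappa> * integral {0..1} b + 1)) {0..1}"
    using has_integral_const_real[of "1::real" 0 1]
    by (intro has_integral_add has_integral_mult_right) (auto intro!: integrable_continuous_real cb)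
  then have "integral {0..1} r = - \<kappa> * integral {0..1} b + 1" unfolding r_b by (rule integral_unique)
  then have r0: "integral {0..1} r = 0" using \<kappa>0(2) by simp
  define q where "q = q_fun a"
  have q: "q = (\<lambda>x. r x / \<kappa>)"
    using \<kappa>0 by (auto simp: q_def q_fun_def r_b b_def \<kappa>_def[symmetric] field_simps)
  have "(LINT x|circle. (q x)\<^sup>2) = integral {0..1} (\<lambda>x. (r x)\<^sup>2 / \<kappa>\<^sup>2)"
    unfolding q power_divide by (intro integral_circle continuous_intros cr) (use \<kappa>0 in auto)
  then have q2: "(LINT x|circle. (q x)\<^sup>2) = integral {0..1} (\<lambda>x. (r x)\<^sup>2) / \<kappa>\<^sup>2" by simp
  have qs: "(LINT x|circle. q x * q (2 ^ Suc s * x)) = integral {0..1} (\<lambda>x. r x * r (2 ^ Suc s * x)) / \<kappa>\<^sup>2" for s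
  proof -
    have "(LINT x|circle. q x * q (2 ^ Suc s * x)) = integral {0..1} (\<lambda>x. r x * r (2 ^ Suc s * x) / \<kappa>\<^sup>2)"
      unfolding q times_divide_times_eq power2_eq_square[symmetric]
      by (intro integral_circle continuous_intros cr continuous_on_compose2[OF cr]) (use \<kappa>0 in auto)
    then show ?thesis by simp
  qed
  have sm: "summable (\<lambda>s. integral {0..1} (\<lambda>x. r x * r (2 ^ Suc s * x)))"
    using integral_mult_poisson[OF r r0] by (rule sums_summable)
  have "8 * (\<kappa> * c_coeff a) = \<kappa>\<^sup>2 * ((LINT x|circle. (q x)\<^sup>2) + 2 * (\<Sum>s. LINT x|circle. q x * q (2 ^ Suc s * x)))"
    by (simp add: c_coeff_def \<kappa>_def q_def power2_eq_square)
  also have "\<dots> = integral {0..1} (\<lambda>x. (r x)\<^sup>2) + 2 * (\<Sum>s. integral {0..1} (\<lambda>x. r x * r (2 ^ Suc s * x)))"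
    unfolding q2 qs suminf_divide[OF sm] using \<kappa>0 by (simp add: field_simps)
  finally show ?thesis using that[OF _ r r0] \<kappa>0 by (simp add: \<kappa>_def)
qed

section \<open>From row growth to the deviation estimate\<close>

lemma eventually_real_ge:
  fixes c d :: real
  assumes "0 < c"
  obtains N\<^sub>0 :: nat where "\<And>N. N \<ge> N\<^sub>0 \<Longrightarrow> d \<le> real N * c" "1 \<le> N\<^sub>0"
proof (rule that[of "max 1 (nat \<lceil>d / c\<rceil>)"])
  fix N assume "max 1 (nat \<lceil>d / c\<rceil>) \<le> N"
  then have "d / c \<le> real N" by linarith
  then show "d \<le> real N * c" using assms by (simp add: field_simps)
qed simp

context phase_drift
begin

lemma log_orbit_event_sets:
  assumes "\<And>y \<phi>. cmod (log_increment \<delta> (r y) \<phi>) \<le> 1 / 2"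
  shows "{x \<in> space circle. c \<le> Re (log_orbit \<delta> l N x)} \<in> sets circle"
    and "{x \<in> space circle. Re (log_orbit \<delta> l N x) \<le> c} \<in> sets circle"
proof -
  have "continuous_on UNIV (\<lambda>x. Re (log_orbit \<delta> l N x))"
    by (intro continuous_intros log_orbit_continuous assms)
  then have [measurable]: "(\<lambda>x. Re (log_orbit \<delta> l N x)) \<in> borel_measurable circle"
    using integral_circle(1) by blast
  show "{x \<in> space circle. c \<le> Re (log_orbit \<delta> l N x)} \<in> sets circle"
    and "{x \<in> space circle. Re (log_orbit \<delta> l N x) \<le> c} \<in> sets circle" by measurable
qed

lemma transfer_norm_bounds:
  assumes per: "\<And>x. a (x + 1) = a x" and m: "0 < m" "\<And>x. m \<le> a x" and M: "\<And>x. \<bar>a x\<bar> \<le> A"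
    and k: "0 < \<kappa>" "0 < E" and r: "\<And>x. r x = 1 - \<kappa> / a x"
    and small: "\<And>y \<phi>. cmod (log_increment (sqrt (E / \<kappa>)) (r y) \<phi>) \<le> 1 / 2"
  obtains B where "1 \<le> B"
    "\<And>N x. exp (Re (log_orbit (sqrt (E / \<kappa>)) 0 N x)) \<le> B * onorm ((*v) (transfer_matrix a E N x))"
    "\<And>N x. onorm ((*v) (transfer_matrix a E N x)) \<le>
      B * (exp (Re (log_orbit (sqrt (E / \<kappa>)) 0 N x)) + exp (Re (log_orbit (sqrt (E / \<kappa>)) (\<i> * pi / 2) N x)))"
proof -
  define w \<delta> where "w = sqrt (E * \<kappa>)" and "\<delta> = sqrt (E / \<kappa>)"
  have w: "0 < w" using k by (simp add: w_def)
  have A0: "0 \<le> A" using M[of 0] by linarith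
  have pos: "0 < a x" for x using m(1) m(2)[of x] by linarith
  define B1 B2 where "B1 = 1 + A + w" and "B2 = 2 + 2 * A + w + (1 + A)\<^sup>2 / w"
  have B: "0 \<le> B1" "0 \<le> B2" using w A0 by (auto simp: B1_def B2_def)
  let ?z = "\<lambda>l N x. exp (log_orbit \<delta> l N x)"
  have z1: "phase_product \<delta> r N x $ 1 = vector [Re (?z 0 N x), Im (?z 0 N x)]" for N x
    using small unfolding \<delta>_def by (intro phase_product_row) (auto simp: vec_eq_iff forall_2 mat_def)
  have z2: "phase_product \<delta> r N x $ 2 = vector [Re (?z (\<i> * pi / 2) N x), Im (?z (\<i> * pi / 2) N x)]" for N x
    using small unfolding \<delta>_def by (intro phase_product_row) (auto simp: vec_eq_iff forall_2 mat_def Re_exp Im_exp)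
  have T: "transfer_matrix a E N x = vector [vector [a (2 ^ N * x), w], vector [1, 0]] **
      phase_product \<delta> r N x ** vector [vector [0, 1], vector [1 / w, - a x / w]]" for N x
    unfolding w_def \<delta>_def by (rule transfer_matrix_conjugation[where a = a and r = r, OF per pos k r])
  have mono: "B1 * t \<le> (1 + B1 + 2 * B2) * t" "B2 * (2 * t) \<le> (1 + B1 + 2 * B2) * t" if "0 \<le> t" for t
    using that B by (auto simp: algebra_simps)
  show ?thesis
  proof (rule that[of "1 + B1 + 2 * B2"])
    show "1 \<le> 1 + B1 + 2 * B2" using B by simp
    fix N x
    let ?n = "onorm ((*v) (transfer_matrix a E N x))"
    note cnb = conjugation_norm_bounds[OF w M[of "2 ^ N * x"] M[of x], of "phase_product \<delta> r N x",
        folded T B1_def B2_def, unfolded z1 z2 vector_2]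
    have "exp (Re (log_orbit \<delta> 0 N x)) \<le> \<bar>Re (?z 0 N x)\<bar> + \<bar>Im (?z 0 N x)\<bar>"
      using cmod_le[of "?z 0 N x"] by simp
    also have "\<dots> \<le> B1 * ?n" by (rule cnb(1))
    also have "\<dots> \<le> (1 + B1 + 2 * B2) * ?n" by (intro mono onorm_pos_le) simp
    finally show "exp (Re (log_orbit (sqrt (E / \<kappa>)) 0 N x)) \<le> (1 + B1 + 2 * B2) * ?n" by (simp add: \<delta>_def)
    define S where "S = exp (Re (log_orbit \<delta> 0 N x)) + exp (Re (log_orbit \<delta> (\<i> * pi / 2) N x))"
    have "\<bar>Re z\<bar> + \<bar>Im z\<bar> \<le> 2 * cmod z" for z using abs_Re_le_cmod[of z] abs_Im_le_cmod[of z] by linarith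
    from add_mono[OF this[of "?z 0 N x"] this[of "?z (\<i> * pi / 2) N x"]]
    have "B2 * (\<bar>Re (?z 0 N x)\<bar> + \<bar>Im (?z 0 N x)\<bar> + \<bar>Re (?z (\<i> * pi / 2) N x)\<bar> + \<bar>Im (?z (\<i> * pi / 2) N x)\<bar>) \<le> B2 * (2 * S)"
      using B by (intro mult_left_mono) (auto simp: S_def)
    then have "?n \<le> B2 * (2 * S)" using cnb(2) by linarith
    also have "\<dots> \<le> (1 + B1 + 2 * B2) * S" by (intro mono) (simp add: S_def add_nonneg_nonneg)
    finally show "?n \<le> (1 + B1 + 2 * B2) * (exp (Re (log_orbit (sqrt (E / \<kappa>)) 0 N x))
        + exp (Re (log_orbit (sqrt (E / \<kappa>)) (\<i> * pi / 2) N x)))" by (simp add: S_def \<delta>_def)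
  qed
qed

end

text \<open>A large norm may come from either row, whereas a small norm makes the first row small.
  The comparison constant costs \<open>ln (2 * B)\<close>, which half of the deviation absorbs for
  large \<open>N\<close>.\<close>

lemma deviation_cases:
  fixes \<mu> n :: real
  assumes B: "1 \<le> B" and low: "exp u \<le> B * n" and up: "n \<le> B * (exp u + exp v)"
    and N: "0 < N" and big: "ln (2 * B) \<le> real N * (h / 2)" and dev: "\<bar>1 / real N * ln n - \<mu>\<bar> > h"
  shows "(\<mu> + h / 2) * N \<le> u \<or> (\<mu> + h / 2) * N \<le> v \<or> u \<le> (\<mu> - h / 2) * N"
proof -
  have "0 < B * n" using low exp_gt_zero[of u] by linarith
  then have n: "0 < n" using B by (simp add: zero_less_mult_iff)
  have "ln n \<le> ln (2 * B) + max u v"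
  proof -
    have "exp u + exp v \<le> 2 * exp (max u v)" by (simp add: max_def)
    then have "B * (exp u + exp v) \<le> B * (2 * exp (max u v))" using B by (intro mult_left_mono) auto
    then have "n \<le> B * (2 * exp (max u v))" using up by linarith
    then have "ln n \<le> ln (2 * B * exp (max u v))" using n B by (subst ln_le_cancel_iff) auto
    then show ?thesis using B by (simp add: ln_mult)
  qed
  moreover have "u \<le> ln (2 * B) + ln n"
  proof -
    have "exp u \<le> 2 * B * n" using low \<open>0 < B * n\<close> by linarith
    then have "ln (exp u) \<le> ln (2 * B * n)" using n B by (subst ln_le_cancel_iff) auto
    then show ?thesis using B n by (simp add: ln_mult)
  qed
  moreover have "(\<mu> + h) * N < ln n \<or> ln n < (\<mu> - h) * N"
    using dev N by (auto simp: field_simps abs_if split: if_splits)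
  ultimately show ?thesis using big by (auto simp: algebra_simps max_def split: if_splits)
qed

theorem theorem1p4:
  fixes a :: "real \<Rightarrow> real"
  assumes "C1_circle a"
    and "0 < (INF x. ereal (a x))"
    and "(INF x. ereal (a x)) < (SUP x. ereal (a x))"
    and "(SUP x. ereal (a x)) < \<infinity>"
    and "c_coeff a > 0"
  shows "\<forall>\<epsilon>>0. \<exists>c>0. \<exists>E\<^sub>0>0. \<forall>E. 0 < E \<and> E < E\<^sub>0 \<longrightarrow>
    (\<exists>N\<^sub>0::nat. \<forall>N\<ge>N\<^sub>0.
      \<P>(x in circle.
          \<bar>1 / real N * ln (onorm ((*v) (transfer_matrix a E N x))) - c_coeff a * E\<bar>
            > \<epsilon> * c_coeff a * E)
      \<le> exp (- c * (E / \<bar>ln E\<bar> ^ 3) * real N))"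
proof (intro allI impI)
  fix \<epsilon> :: real assume \<epsilon>: "0 < \<epsilon>"
  have per: "a (x + 1) = a x" for x using assms(1) by (auto simp: C1_circle_def)
  obtain C where a: "circle_lipschitz C a" using C1_circle_lipschitz[OF assms(1)] .
  obtain m where m: "0 < m" "\<And>x. m \<le> a x" using C1_circle_lower_bound[OF per assms(2)] by blast
  obtain A where A: "\<And>x. \<bar>a x\<bar> \<le> A" using circle_lipschitz_bounded[OF a] by blast
  define \<kappa> r \<gamma> where "\<kappa> = kappa a" and "r = (\<lambda>x. 1 - \<kappa> / a x)" and "\<gamma> = \<kappa> * c_coeff a"
  obtain D' where \<kappa>: "0 < \<kappa>" and r: "circle_lipschitz D' r" "integral {0..1} r = 0"
    and \<gamma>: "8 * \<gamma> = integral {0..1} (\<lambda>x. (r x)\<^sup>2) + 2 * (\<Sum>s. integral {0..1} (\<lambda>x. r x * r (2 ^ Suc s * x)))"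
    by (rule circle_data[OF a m r_def[unfolded \<kappa>_def], folded \<kappa>_def, folded \<gamma>_def])
  obtain G K J M where "phase_drift r G K J \<gamma> M" using exists_phase_drift[OF r \<gamma>] .
  then interpret phase_drift r G K J \<gamma> M .
  \<comment> \<open>Half of the allowed relative deviation; the other half pays for passing from
    rows to the norm.\<close>
  have \<eta>: "0 < \<epsilon> * \<gamma> / 2" using \<kappa> \<epsilon> assms(5) by (simp add: \<gamma>_def)
  obtain s D \<delta>\<^sub>1 where s: "0 < s" and D: "1 \<le> D" and \<delta>\<^sub>1: "0 < \<delta>\<^sub>1" "\<delta>\<^sub>1 \<le> 1"
    and small: "\<And>\<delta> y \<phi>. 0 < \<delta> \<Longrightarrow> \<delta> \<le> \<delta>\<^sub>1 \<Longrightarrow> cmod (log_increment \<delta> (r y) \<phi>) \<le> 1 / 2"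
    and upper: "\<And>\<delta> l N. 0 < \<delta> \<Longrightarrow> \<delta> \<le> \<delta>\<^sub>1 \<Longrightarrow> Re l = 0 \<Longrightarrow>
       measure circle {x \<in> space circle. (\<gamma> + \<epsilon> * \<gamma> / 2) * \<delta>\<^sup>2 * real N \<le> Re (log_orbit \<delta> l N x)} \<le> D * exp (- s * \<delta>\<^sup>2 * N)"
    and lower: "\<And>\<delta> l N. 0 < \<delta> \<Longrightarrow> \<delta> \<le> \<delta>\<^sub>1 \<Longrightarrow> Re l = 0 \<Longrightarrow>
       measure circle {x \<in> space circle. Re (log_orbit \<delta> l N x) \<le> (\<gamma> - \<epsilon> * \<gamma> / 2) * \<delta>\<^sup>2 * real N} \<le> D * exp (- s * \<delta>\<^sup>2 * N)"
    using large_deviations[OF \<eta>] by blast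
  \<comment> \<open>As \<open>\<delta>\<^sup>2 = E / \<kappa>\<close>, this is half of the rate for
    the rows; the other half absorbs the prefactor \<open>3 * D\<close> of the three events once
    \<open>N\<close> is large. In \<open>E\<^sub>0\<close>, the bound \<open>exp (- 1)\<close>
    ensures that \<open>ln E\<close> has absolute value at least 1, and
    \<open>\<kappa> * \<delta>\<^sub>1\<^sup>2\<close> ensures
    \<open>\<delta> \<le> \<delta>\<^sub>1\<close>.\<close>
  define c where "c = s / (2 * \<kappa>)"
  define E\<^sub>0 where "E\<^sub>0 = min (exp (- 1)) (\<kappa> * \<delta>\<^sub>1\<^sup>2)"
  have "\<exists>N\<^sub>0::nat. \<forall>N\<ge>N\<^sub>0.
      \<P>(x in circle.
          \<bar>1 / real N * ln (onorm ((*v) (transfer_matrix a E N x))) - c_coeff a * E\<bar>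
            > \<epsilon> * c_coeff a * E)
      \<le> exp (- c * (E / \<bar>ln E\<bar> ^ 3) * real N)" if E: "0 < E" "E < E\<^sub>0" for E
  proof -
    define \<delta> where "\<delta> = sqrt (E / \<kappa>)"
    have \<delta>2: "\<delta>\<^sup>2 = E / \<kappa>" and \<delta>0: "0 < \<delta>" using E \<kappa> by (auto simp: \<delta>_def)
    have "\<delta>\<^sup>2 \<le> \<delta>\<^sub>1\<^sup>2" unfolding \<delta>2 using E \<kappa> by (simp add: E\<^sub>0_def field_simps)
    then have \<delta>: "0 < \<delta>" "\<delta> \<le> \<delta>\<^sub>1" using \<delta>0 \<delta>\<^sub>1 by (auto intro: power2_le_imp_le)
    have sm: "cmod (log_increment \<delta> (r y) \<phi>) \<le> 1 / 2" for y \<phi> by (rule small[OF \<delta>])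
    have r_eq: "r x = 1 - \<kappa> / a x" for x by (simp add: r_def)
    obtain B where B: "1 \<le> B"
      and B1: "\<And>N x. exp (Re (log_orbit \<delta> 0 N x)) \<le> B * onorm ((*v) (transfer_matrix a E N x))"
      and B2: "\<And>N x. onorm ((*v) (transfer_matrix a E N x)) \<le>
        B * (exp (Re (log_orbit \<delta> 0 N x)) + exp (Re (log_orbit \<delta> (\<i> * pi / 2) N x)))"
      using transfer_norm_bounds[where a = a, OF per m A \<kappa> E(1) r_eq sm[unfolded \<delta>_def], folded \<delta>_def] by blast
    define \<mu> h where "\<mu> = c_coeff a * E" and "h = \<epsilon> * c_coeff a * E"
    have h: "0 < h" using \<epsilon> assms(5) E by (simp add: h_def)
    \<comment> \<open>Here \<open>\<gamma> * \<delta>\<^sup>2\<close> becomes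
      \<open>c_coeff a * E\<close>, because \<open>\<gamma> = \<kappa> * c_coeff a\<close>.\<close>
    have \<mu>_eq: "(\<gamma> + \<epsilon> * \<gamma> / 2) * \<delta>\<^sup>2 = \<mu> + h / 2" "(\<gamma> - \<epsilon> * \<gamma> / 2) * \<delta>\<^sup>2 = \<mu> - h / 2"
      unfolding \<delta>2 \<gamma>_def \<mu>_def h_def using \<kappa> by (auto simp: field_simps)
    obtain N1 :: nat where N1: "\<And>N. N1 \<le> N \<Longrightarrow> ln (2 * B) \<le> real N * (h / 2)" "1 \<le> N1"
      using eventually_real_ge[of "h / 2" "ln (2 * B)"] h by (metis half_gt_zero)
    have s\<delta>: "0 < s * \<delta>\<^sup>2 / 2" using s \<delta> by simp
    obtain N2 :: nat where N2: "\<And>N. N2 \<le> N \<Longrightarrow> ln (3 * D) \<le> real N * (s * \<delta>\<^sup>2 / 2)"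
      using eventually_real_ge[OF s\<delta>, of "ln (3 * D)"] by metis
    show ?thesis
    proof (intro exI[of _ "max N1 N2"] allI impI)
      fix N assume "max N1 N2 \<le> N"
      then have N: "N1 \<le> N" "N2 \<le> N" "0 < N" using N1(2) by auto
      interpret finite_measure circle by (rule finite_measure_circle)
      define S1 S2 S3 where "S1 = {x \<in> space circle. (\<mu> + h / 2) * N \<le> Re (log_orbit \<delta> 0 N x)}"
        and "S2 = {x \<in> space circle. (\<mu> + h / 2) * N \<le> Re (log_orbit \<delta> (\<i> * pi / 2) N x)}"
        and "S3 = {x \<in> space circle. Re (log_orbit \<delta> 0 N x) \<le> (\<mu> - h / 2) * N}"
      have sets: "S1 \<in> sets circle" "S2 \<in> sets circle" "S3 \<in> sets circle"
        unfolding S1_def S2_def S3_def by (intro log_orbit_event_sets sm)+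
      have bounds: "measure circle S1 \<le> D * exp (- s * \<delta>\<^sup>2 * N)" "measure circle S2 \<le> D * exp (- s * \<delta>\<^sup>2 * N)"
        "measure circle S3 \<le> D * exp (- s * \<delta>\<^sup>2 * N)"
        unfolding S1_def S2_def S3_def \<mu>_eq[symmetric] by (intro upper lower \<delta>; simp)+
      let ?bad = "{x \<in> space circle. \<bar>1 / real N * ln (onorm ((*v) (transfer_matrix a E N x))) - \<mu>\<bar> > h}"
      have "?bad \<subseteq> S1 \<union> S2 \<union> S3"
        using deviation_cases[OF B B1 B2 N(3) N1(1)[OF N(1)]] by (auto simp: S1_def S2_def S3_def)
      then have "measure circle ?bad \<le> measure circle (S1 \<union> S2 \<union> S3)"
        using sets by (intro finite_measure_mono) auto
      also have "\<dots> \<le> measure circle (S1 \<union> S2) + measure circle S3"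
        using sets by (intro measure_Un_le) auto
      also have "\<dots> \<le> (measure circle S1 + measure circle S2) + measure circle S3"
        using sets by (intro add_right_mono measure_Un_le) auto
      also have "\<dots> \<le> 3 * D * exp (- s * \<delta>\<^sup>2 * N)" using bounds by linarith
      also have "\<dots> = exp (ln (3 * D) + - s * \<delta>\<^sup>2 * N)" unfolding exp_add using D by simp
      also have "\<dots> \<le> exp (- (s * \<delta>\<^sup>2 / 2) * N)" using N2[OF N(2)] by (simp add: algebra_simps)
      also have "\<dots> = exp (- (c * E * N))" by (simp add: \<delta>2 c_def)
      also have "\<dots> \<le> exp (- c * (E / \<bar>ln E\<bar> ^ 3) * N)"
      proof -
        have "ln E < ln (exp (- 1))" using E by (subst ln_less_cancel_iff) (auto simp: E\<^sub>0_def)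
        then have "1 \<le> \<bar>ln E\<bar> ^ 3" by (intro one_le_power) auto
        then have "E / \<bar>ln E\<bar> ^ 3 \<le> E / 1" using E by (intro divide_left_mono) auto
        then have "c * (E / \<bar>ln E\<bar> ^ 3) * N \<le> c * E * N"
          using s \<kappa> by (intro mult_right_mono mult_left_mono) (auto simp: c_def)
        then show ?thesis by simp
      qed
      finally show "\<P>(x in circle.
          \<bar>1 / real N * ln (onorm ((*v) (transfer_matrix a E N x))) - c_coeff a * E\<bar>
            > \<epsilon> * c_coeff a * E)
        \<le> exp (- c * (E / \<bar>ln E\<bar> ^ 3) * real N)" by (simp add: \<mu>_def h_def)
    qed
  qed
  moreover have "0 < c" "0 < E\<^sub>0" using s \<kappa> \<delta>\<^sub>1 by (auto simp: c_def E\<^sub>0_def)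
  ultimately show "\<exists>c>0. \<exists>E\<^sub>0>0. \<forall>E. 0 < E \<and> E < E\<^sub>0 \<longrightarrow>
    (\<exists>N\<^sub>0::nat. \<forall>N\<ge>N\<^sub>0.
      \<P>(x in circle.
          \<bar>1 / real N * ln (onorm ((*v) (transfer_matrix a E N x))) - c_coeff a * E\<bar>
            > \<epsilon> * c_coeff a * E)
      \<le> exp (- c * (E / \<bar>ln E\<bar> ^ 3) * real N))" by blast
qed

end
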